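(* Let $\theta_1,\theta_2$ be inner functions on $\mathbb{D}$. The quotient module $\mathfrak{Q}=H^2(\mathbb{D}^2)\ominus\theta_1(z)\theta_2(w)H^2(\mathbb{D}^2)$ is $\varphi$-doubly commuting if and only if one of the following holds: (i) $\theta_1$ and $\theta_2$ are constant functions; (ii) $\theta_1$ is constant and $\theta_2(w)=c\,\frac{w-b}{1-\bar bw}$ for some $b\in\mathbb{D}$ and $c\in\mathbb{T}$; (iii) $\theta_2$ is constant and $\theta_1(z)=c_1z$ for some $c_1\in\mathbb{T}$; (iv) $\theta_1(z)=c_1z$ and $\theta_2(w)=c_2w$ for some $c_1,c_2\in\mathbb{T}$.
   Context: $H^2(\mathbb{D}^2)$ is the Hardy space of the bidisc and $M_1,M_2$ are multiplication by the coordinates $z$ and $w$ on it. A quotient module is a closed subspace $\mathfrak{Q}$ invariant under $M_1^*$ and $M_2^*$; put $Q_i=P_{\mathfrak{Q}}M_i|_{\mathfrak{Q}}$, $i=1,2$, with $P_{\mathfrak Q}$ the orthogonal projection onto $\mathfrak{Q}$. $\mathfrak{Q}$ is $\varphi$-doubly commuting if $Q_1Q_2Q_2^*=Q_2^*Q_1Q_2$. Constant functions of modulus one are inner. $\ominus$ denotes orthogonal complement. *)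

theory Defs
  imports "HOL-Complex_Analysis.Complex_Analysis"
begin

text \<open>Functions on the bidisc are total functions on \<^typ>\<open>complex \<times> complex\<close> that vanish off
  the bidisc, so that equality of functions is equality on the bidisc.\<close>

definition bidisc :: "(complex \<times> complex) set" where
  "bidisc = ball 0 1 \<times> ball 0 1"

definition bidisc_powser ::
    "(nat \<Rightarrow> nat \<Rightarrow> complex) \<Rightarrow> (complex \<times> complex \<Rightarrow> complex) \<Rightarrow> bool" where
  "bidisc_powser a f \<longleftrightarrow>
     (\<forall>(z, w)\<in>bidisc. ((\<lambda>(m, n). a m n * z ^ m * w ^ n) has_sum f (z, w)) UNIV)"

definition hardy2 :: "(complex \<times> complex \<Rightarrow> complex) set" where
  "hardy2 = {f. (\<forall>p. p \<notin> bidisc \<longrightarrow> f p = 0) \<and>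
     (\<exists>a. bidisc_powser a f \<and> (\<lambda>(m, n). (cmod (a m n))\<^sup>2) summable_on UNIV)}"

text \<open>The power series coefficients of a function on the bidisc are unique when they exist.\<close>

definition bidisc_coeff :: "(complex \<times> complex \<Rightarrow> complex) \<Rightarrow> nat \<Rightarrow> nat \<Rightarrow> complex" where
  "bidisc_coeff f = (THE a. bidisc_powser a f)"

definition hinner ::
    "(complex \<times> complex \<Rightarrow> complex) \<Rightarrow> (complex \<times> complex \<Rightarrow> complex) \<Rightarrow> complex" where
  "hinner f g = (\<Sum>\<^sub>\<infinity>(m, n)\<in>UNIV. bidisc_coeff f m n * cnj (bidisc_coeff g m n))"

definition hnorm :: "(complex \<times> complex \<Rightarrow> complex) \<Rightarrow> real" where
  "hnorm f = sqrt (Re (hinner f f))"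

definition closed_subspace :: "(complex \<times> complex \<Rightarrow> complex) set \<Rightarrow> bool" where
  "closed_subspace S \<longleftrightarrow>
     S \<subseteq> hardy2 \<and>
     (\<lambda>p. 0) \<in> S \<and>
     (\<forall>f\<in>S. \<forall>g\<in>S. (\<lambda>p. f p + g p) \<in> S) \<and>
     (\<forall>c. \<forall>f\<in>S. (\<lambda>p. c * f p) \<in> S) \<and>
     (\<forall>F. \<forall>f\<in>hardy2. (\<forall>k::nat. F k \<in> S) \<longrightarrow>
        (\<lambda>k. hnorm (\<lambda>p. F k p - f p)) \<longlonglongrightarrow> 0 \<longrightarrow> f \<in> S)"

definition orth_compl ::
    "(complex \<times> complex \<Rightarrow> complex) set \<Rightarrow> (complex \<times> complex \<Rightarrow> complex) set" where
  "orth_compl S = {f\<in>hardy2. \<forall>g\<in>S. hinner f g = 0}"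

definition orth_proj ::
    "(complex \<times> complex \<Rightarrow> complex) set \<Rightarrow>
     (complex \<times> complex \<Rightarrow> complex) \<Rightarrow> (complex \<times> complex \<Rightarrow> complex)" where
  "orth_proj S f = (THE g. g \<in> S \<and> (\<lambda>p. f p - g p) \<in> orth_compl S)"

text \<open>The Hilbert space adjoint of a bounded operator from the closed subspace \<open>S\<close> to itself.\<close>

definition adjoint_on ::
    "(complex \<times> complex \<Rightarrow> complex) set \<Rightarrow>
     ((complex \<times> complex \<Rightarrow> complex) \<Rightarrow> (complex \<times> complex \<Rightarrow> complex)) \<Rightarrow>
     (complex \<times> complex \<Rightarrow> complex) \<Rightarrow> (complex \<times> complex \<Rightarrow> complex)" where
  "adjoint_on S T g = (THE h. h \<in> S \<and> (\<forall>f\<in>S. hinner (T f) g = hinner f h))"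

definition M1 :: "(complex \<times> complex \<Rightarrow> complex) \<Rightarrow> (complex \<times> complex \<Rightarrow> complex)" where
  "M1 f = (\<lambda>(z, w). z * f (z, w))"

definition M2 :: "(complex \<times> complex \<Rightarrow> complex) \<Rightarrow> (complex \<times> complex \<Rightarrow> complex)" where
  "M2 f = (\<lambda>(z, w). w * f (z, w))"

definition quotient_module :: "(complex \<times> complex \<Rightarrow> complex) set \<Rightarrow> bool" where
  "quotient_module Q \<longleftrightarrow>
     closed_subspace Q \<and>
     (\<forall>f\<in>Q. adjoint_on hardy2 M1 f \<in> Q) \<and>
     (\<forall>f\<in>Q. adjoint_on hardy2 M2 f \<in> Q)"

definition compression ::
    "(complex \<times> complex \<Rightarrow> complex) set \<Rightarrow>
     ((complex \<times> complex \<Rightarrow> complex) \<Rightarrow> (complex \<times> complex \<Rightarrow> complex)) \<Rightarrow>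
     (complex \<times> complex \<Rightarrow> complex) \<Rightarrow> (complex \<times> complex \<Rightarrow> complex)" where
  "compression Q T f = orth_proj Q (T f)"

definition phi_doubly_commuting :: "(complex \<times> complex \<Rightarrow> complex) set \<Rightarrow> bool" where
  "phi_doubly_commuting Q \<longleftrightarrow>
     quotient_module Q \<and>
     (let Q1 = compression Q M1; Q2 = compression Q M2; Q2s = adjoint_on Q Q2
      in \<forall>f\<in>Q. Q1 (Q2 (Q2s f)) = Q2s (Q1 (Q2 f)))"

text \<open>A bounded holomorphic function on the disc whose radial limits exist (which for such
  functions is Fatou's theorem) and are unimodular almost everywhere on the circle.\<close>

definition inner_function :: "(complex \<Rightarrow> complex) \<Rightarrow> bool" where
  "inner_function \<theta> \<longleftrightarrow>
     \<theta> holomorphic_on ball 0 1 \<and>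
     bounded (\<theta> ` ball 0 1) \<and>
     (AE t in lebesgue_on {0..2 * pi}.
        \<exists>l. cmod l = 1 \<and> ((\<lambda>r. \<theta> (of_real r * cis t)) \<longlongrightarrow> l) (at_left 1))"

definition product_submodule ::
    "(complex \<Rightarrow> complex) \<Rightarrow> (complex \<Rightarrow> complex) \<Rightarrow> (complex \<times> complex \<Rightarrow> complex) set" where
  "product_submodule \<theta>\<^sub>1 \<theta>\<^sub>2 = (\<lambda>f. \<lambda>(z, w). \<theta>\<^sub>1 z * \<theta>\<^sub>2 w * f (z, w)) ` hardy2"

end

theory Submission
  imports Defs
begin

text \<open>Write \<open>u\<close> for the multiplier \<open>\<theta>\<^sub>1(z) \<theta>\<^sub>2(w)\<close>, \<open>A\<close> for the adjoint of multiplication by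
  \<open>u\<close>, and \<open>B\<^sub>1\<close>, \<open>B\<^sub>2\<close> for the backward shifts, the adjoints of multiplication by \<open>z\<close> and \<open>w\<close>.
  Multiplication by \<open>u\<close> is an isometry of the Hardy space, so the quotient module \<open>Q\<close> is the
  kernel of \<open>A\<close>, the projection onto \<open>Q\<close> is \<open>P f = f - u \<cdot> A f\<close>, and \<open>Q\<^sub>2\<close> has the adjoint \<open>B\<^sub>2\<close>
  on \<open>Q\<close>. As \<open>P\<close> kills multiples of \<open>u\<close>, the condition \<open>Q\<^sub>1 Q\<^sub>2 Q\<^sub>2\<^sup>* = Q\<^sub>2\<^sup>* Q\<^sub>1 Q\<^sub>2\<close> becomes
  \<open>P(z w B\<^sub>2 f) = B\<^sub>2 P(z w f)\<close> for \<open>f\<close> in \<open>Q\<close>. Pairing it with \<open>h\<close> in \<open>Q\<close> gives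
  \<open>\<langle>z f(z,0), h\<rangle> = \<langle>A(z w f), A(w h)\<rangle>\<close> (\<open>phi_doubly_commuting_weak\<close>), and the
  necessity of the four cases follows by inserting a few test vectors.

  First let \<open>f\<close> and \<open>h\<close> be functions of \<open>z\<close> in the kernel of the adjoint of \<open>\<theta>\<^sub>1\<close>. The right-hand side
  vanishes, so \<open>\<langle>z f, h\<rangle> = 0\<close>. Take \<open>f = (\<theta>\<^sub>1 - a)/z\<close> and
  \<open>h = 1 - a\<^sup>* \<theta>\<^sub>1\<close>, with \<open>a = \<theta>\<^sub>1(0)\<close> and \<open>a\<^sup>*\<close> its conjugate: this yields
  \<open>a (1 - |a|\<^sup>2) = 0\<close>. If \<open>|a| = 1\<close> then \<open>\<theta>\<^sub>1\<close> is constant;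
  if \<open>a = 0\<close>, one more test with \<open>\<theta>\<^sub>1/z\<close> forces \<open>\<theta>\<^sub>1 = c z\<close> (\<open>first_factor\<close>).
  In both cases the vectors \<open>f = \<phi>(w)\<close> and \<open>h = z \<chi>(w)\<close> reduce the identity to
  \<open>\<phi>(0) \<chi>(0)\<^sup>* = \<langle>A\<^sub>2(w \<phi>), A\<^sub>2(w \<chi>)\<rangle>\<close>, \<open>A\<^sub>2\<close> being the adjoint of
  multiplication by \<open>\<theta>\<^sub>2\<close> (\<open>second_factor_identity\<close>). When \<open>\<theta>\<^sub>1\<close> is constant, \<open>\<phi>\<close> and
  \<open>\<chi>\<close> range over the kernel of \<open>A\<^sub>2\<close>, and the test vector \<open>(\<theta>\<^sub>2 - a)/w\<close>, with \<open>a = \<theta>\<^sub>2(0)\<close> from here on,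
  gives equality in a Cauchy-Schwarz estimate unless \<open>\<theta>\<^sub>2\<close> is constant, hence
  \<open>\<theta>\<^sub>2 - a = \<lambda> w (1 - a\<^sup>* \<theta>\<^sub>2)\<close>, a Moebius map (\<open>second_factor_Moebius\<close>). When
  \<open>\<theta>\<^sub>1 = c z\<close>, every \<open>\<phi>\<close> is admissible, and \<open>\<phi> = \<theta>\<^sub>2\<close> forces \<open>a = 0\<close> or
  \<open>|a| = 1\<close>; then \<open>\<phi> = \<chi> = 1\<close> forces \<open>\<theta>\<^sub>2 = c w\<close> if \<open>a = 0\<close> (\<open>second_factor_linear\<close>).

  Conversely, \<open>z w\<close> is a multiple of \<open>u\<close> in three of the four cases, so both sides
  of the condition vanish, and in the Moebius case \<open>B\<^sub>2\<close> is a scalar on \<open>Q\<close>, which makes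
  the condition trivial.

  The analytic input is that an inner function multiplies isometrically. The sequence of its
  Taylor coefficients has norm one and is orthogonal to its shifts: on circles of radius \<open>r < 1\<close> this is Parseval, and
  dominated convergence passes to the boundary (\<open>inner_function_coefficients\<close>). Boundedness
  and the adjoint then come from Bessel's inequality and Riesz representation
  (\<open>mult_hardy2_and_adjoint\<close>), without computing products of power series.\<close>

section \<open>Square-summable coefficients and the Hardy space\<close>

definition bimonom :: "nat \<times> nat \<Rightarrow> complex \<times> complex \<Rightarrow> complex" where
  "bimonom q p = fst p ^ fst q * snd p ^ snd q"

text \<open>The uncurried coefficient array, so that sums over it are sums over one index.\<close>

definition coef :: "(complex \<times> complex \<Rightarrow> complex) \<Rightarrow> nat \<times> nat \<Rightarrow> complex" where
  "coef f q = bidisc_coeff f (fst q) (snd q)"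

definition sq_summable :: "('a \<Rightarrow> complex) \<Rightarrow> bool" where
  "sq_summable a \<longleftrightarrow> (\<lambda>q. (cmod (a q))\<^sup>2) summable_on UNIV"

definition of_coef :: "(nat \<times> nat \<Rightarrow> complex) \<Rightarrow> complex \<times> complex \<Rightarrow> complex" where
  "of_coef a p = (if p \<in> bidisc then \<Sum>\<^sub>\<infinity>q. a q * bimonom q p else 0)"

lemma bidisc_iff: "(z, w) \<in> bidisc \<longleftrightarrow> cmod z < 1 \<and> cmod w < 1"
  by (simp add: bidisc_def)

lemma sq_summable_mult:
  assumes "sq_summable a" "sq_summable b"
  shows "(\<lambda>q. a q * b q) summable_on UNIV"
proof -
  have "(\<lambda>q. norm (a q * b q)) summable_on UNIV"
    by (rule abs_summable_product)
      (use assms in \<open>simp_all add: sq_summable_def norm_mult power2_eq_square\<close>)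
  then show ?thesis by (rule abs_summable_summable)
qed

lemma sq_summable_cnj: "sq_summable a \<Longrightarrow> sq_summable (\<lambda>q. cnj (a q))"
  by (simp add: sq_summable_def)

lemma sq_summable_inner:
  "sq_summable a \<Longrightarrow> sq_summable b \<Longrightarrow> (\<lambda>q. a q * cnj (b q)) summable_on UNIV"
  by (intro sq_summable_mult sq_summable_cnj)

lemma sq_summable_cmult: "sq_summable a \<Longrightarrow> sq_summable (\<lambda>q. c * a q)"
  by (simp add: sq_summable_def norm_mult power_mult_distrib summable_on_cmult_right)

lemma sq_summable_add:
  assumes "sq_summable a" "sq_summable b"
  shows "sq_summable (\<lambda>q. a q + b q)"
  unfolding sq_summable_def
proof (rule summable_on_comparison_test)
  show "(\<lambda>q. 2 * (cmod (a q))\<^sup>2 + 2 * (cmod (b q))\<^sup>2) summable_on UNIV"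
    using assms unfolding sq_summable_def by (intro summable_on_add summable_on_cmult_right)
  fix q
  have "(cmod (a q + b q))\<^sup>2 \<le> (cmod (a q) + cmod (b q))\<^sup>2"
    by (intro power_mono norm_triangle_ineq) auto
  also have "\<dots> \<le> 2 * (cmod (a q))\<^sup>2 + 2 * (cmod (b q))\<^sup>2"
    by (smt (verit) sum_squares_bound power2_sum)
  finally show "(cmod (a q + b q))\<^sup>2 \<le> 2 * (cmod (a q))\<^sup>2 + 2 * (cmod (b q))\<^sup>2" .
qed auto

lemma has_sum_geometric:
  fixes x :: real assumes "0 \<le> x" "x < 1"
  shows "((\<lambda>n. x ^ n) has_sum (1 / (1 - x))) UNIV"
  using assms by (intro norm_summable_imp_has_sum geometric_sums) (auto intro!: summable_geometric)

lemma sq_summable_bimonom: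
  assumes "p \<in> bidisc"
  shows "sq_summable (\<lambda>q. bimonom q p)"
proof -
  obtain z w where p: "p = (z, w)" and zw: "cmod z < 1" "cmod w < 1"
    using assms by (cases p) (auto simp: bidisc_iff)
  have z: "(cmod z)\<^sup>2 < 1" and w: "(cmod w)\<^sup>2 < 1"
    using zw by (simp_all add: power_less_one_iff abs_square_less_1)
  have "(\<lambda>q. (cmod (bimonom q p))\<^sup>2) summable_on (UNIV \<times> UNIV)"
  proof (rule summable_on_SigmaI)
    show "((\<lambda>n. (cmod (bimonom (m, n) p))\<^sup>2) has_sum ((cmod z)\<^sup>2) ^ m * (1 / (1 - (cmod w)\<^sup>2))) UNIV"
      for m
      using has_sum_cmult_right[OF has_sum_geometric[OF _ w], of "((cmod z)\<^sup>2) ^ m"]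
      by (simp add: bimonom_def p norm_mult norm_power power_mult_distrib mult.commute flip: power_mult)
    show "(\<lambda>m. ((cmod z)\<^sup>2) ^ m * (1 / (1 - (cmod w)\<^sup>2))) summable_on UNIV"
      by (rule has_sum_imp_summable[OF has_sum_cmult_left[OF has_sum_geometric[OF _ z]]]) simp
  qed auto
  then show ?thesis by (simp add: sq_summable_def)
qed

lemma powser_zero:
  fixes a :: "nat \<Rightarrow> complex"
  assumes "\<And>z. cmod z < 1 \<Longrightarrow> (\<lambda>n. a n * z ^ n) sums 0"
  shows "a n = 0"
proof (cases "n = 0")
  case True
  have "(\<lambda>n. a n * 0 ^ n) sums a 0" using powser_sums_zero[of a] by simp
  then show ?thesis using assms[of 0] True sums_unique2 by fastforce
next
  case False
  show ?thesis
  proof (rule ccontr)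
    assume "a n \<noteq> 0"
    have sums: "(\<lambda>n. a n * (z - 0) ^ n) sums 0" if "cmod (z - 0) < 1" for z
      using assms[of z] that by simp
    show False
    proof (rule powser_0_nonzero[of 1 0 a "\<lambda>_. 0" n, OF _ sums])
      fix s :: real
      assume "0 < s" and s: "\<And>z. z \<in> cball (0::complex) s - {0} \<Longrightarrow> (0::complex) \<noteq> 0"
      from s[of "of_real s"] \<open>0 < s\<close> show False by simp
    qed (use \<open>a n \<noteq> 0\<close> False in simp_all)
  qed
qed

text \<open>The zero series is summed first over \<open>n\<close>: for fixed \<open>w\<close> its inner sums are the coefficients of
  a vanishing power series in \<open>z\<close>, and each of them is a vanishing power series in \<open>w\<close>.\<close>

lemma double_powser_zero:
  assumes "\<And>p. p \<in> bidisc \<Longrightarrow> ((\<lambda>q. d q * bimonom q p) has_sum 0) UNIV"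
  shows "d (m, n) = 0"
proof -
  have slice: "(\<lambda>n. d (m, n) * w ^ n) summable_on UNIV" if w: "cmod w < 1" for m w
  proof -
    have "(\<lambda>(m, n). d (m, n) * bimonom (m, n) (1/2, w)) summable_on (UNIV \<times> UNIV)"
      using has_sum_imp_summable[OF assms[of "(1/2, w)"]] w by (simp add: bidisc_iff case_prod_unfold)
    from summable_on_SigmaD1[OF this, of m]
    have "(\<lambda>n. (1/2) ^ m * (d (m, n) * w ^ n)) summable_on UNIV"
      by (simp add: bimonom_def mult_ac)
    then show ?thesis by (subst (asm) summable_on_cmult_right') simp_all
  qed
  have "(\<Sum>\<^sub>\<infinity>n. d (m, n) * w ^ n) = 0" if w: "cmod w < 1" for m w
  proof (rule powser_zero[of "\<lambda>m. \<Sum>\<^sub>\<infinity>n. d (m, n) * w ^ n"])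
    fix z :: complex assume z: "cmod z < 1"
    have "((\<lambda>m. (\<Sum>\<^sub>\<infinity>n. d (m, n) * w ^ n) * z ^ m) has_sum 0) UNIV"
    proof (rule has_sum_SigmaD)
      show "((\<lambda>q. d q * bimonom q (z, w)) has_sum 0) (UNIV \<times> UNIV)"
        using assms[of "(z, w)"] z w by (simp add: bidisc_iff)
      show "((\<lambda>n. d (m, n) * bimonom (m, n) (z, w)) has_sum (\<Sum>\<^sub>\<infinity>n. d (m, n) * w ^ n) * z ^ m) UNIV" for m
        using has_sum_cmult_left[OF has_sum_infsum[OF slice[OF w, of m]], of "z ^ m"]
        by (simp add: bimonom_def mult_ac)
    qed
    then show "(\<lambda>m. (\<Sum>\<^sub>\<infinity>n. d (m, n) * w ^ n) * z ^ m) sums 0" by (rule has_sum_imp_sums)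
  qed
  then have "(\<lambda>n. d (m, n) * w ^ n) sums 0" if "cmod w < 1" for w
    using has_sum_imp_sums[OF has_sum_infsum[OF slice[OF that, of m]]] that by simp
  then show ?thesis by (rule powser_zero)
qed

lemma bidisc_powser_iff:
  "bidisc_powser (\<lambda>m n. a (m, n)) f \<longleftrightarrow> (\<forall>p\<in>bidisc. ((\<lambda>q. a q * bimonom q p) has_sum f p) UNIV)"
  by (auto simp: bidisc_powser_def bimonom_def case_prod_unfold mult_ac)

text \<open>Uniqueness of the coefficients resolves the definite description in \<open>bidisc_coeff\<close>. Together with
  \<open>of_coef_hardy2\<close> this identifies \<open>hardy2\<close> with the square-summable arrays.\<close>

lemma coef_eqI:
  assumes "\<And>p. p \<in> bidisc \<Longrightarrow> ((\<lambda>q. a q * bimonom q p) has_sum f p) UNIV"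
  shows "coef f = a"
proof -
  have 1: "bidisc_powser (\<lambda>m n. a (m, n)) f"
    using assms by (simp add: bidisc_powser_iff)
  have "b = (\<lambda>m n. a (m, n))" if "bidisc_powser b f" for b
  proof (intro ext)
    fix m n
    have b: "((\<lambda>q. b (fst q) (snd q) * bimonom q p) has_sum f p) UNIV" if "p \<in> bidisc" for p
      using \<open>bidisc_powser b f\<close> bidisc_powser_iff[of "\<lambda>q. b (fst q) (snd q)" f] that by simp
    have "((\<lambda>q. (b (fst q) (snd q) + (- 1) * a q) * bimonom q p) has_sum (f p + (-1) * f p)) UNIV"
      if "p \<in> bidisc" for p
      using has_sum_add[OF b[OF that] has_sum_cmult_right[OF assms[OF that], of "-1"]]
      by (simp add: algebra_simps)
    then have "b (fst (m, n)) (snd (m, n)) + (- 1) * a (m, n) = 0"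
      by (intro double_powser_zero) simp
    then show "b m n = a (m, n)" by simp
  qed
  then have "bidisc_coeff f = (\<lambda>m n. a (m, n))"
    unfolding bidisc_coeff_def by (intro the_equality 1)
  then show ?thesis by (auto simp: coef_def fun_eq_iff)
qed

lemma of_coef_has_sum:
  assumes "sq_summable a" "p \<in> bidisc"
  shows "((\<lambda>q. a q * bimonom q p) has_sum of_coef a p) UNIV"
  using assms by (simp add: of_coef_def sq_summable_mult sq_summable_bimonom)

lemma coef_of_coef: "sq_summable a \<Longrightarrow> coef (of_coef a) = a"
  by (rule coef_eqI) (rule of_coef_has_sum)

lemma of_coef_hardy2: "sq_summable a \<Longrightarrow> of_coef a \<in> hardy2"
  unfolding hardy2_def
  using of_coef_has_sum[of a] bidisc_powser_iff[of a "of_coef a"]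
  by (auto simp: of_coef_def sq_summable_def case_prod_unfold intro!: exI[of _ "\<lambda>m n. a (m, n)"])

lemma hardy2_obtain_coef:
  assumes "f \<in> hardy2"
  shows "sq_summable (coef f)" and "of_coef (coef f) = f"
proof -
  obtain a where a: "bidisc_powser a f" "(\<lambda>(m, n). (cmod (a m n))\<^sup>2) summable_on UNIV"
    and f0: "\<And>p. p \<notin> bidisc \<Longrightarrow> f p = 0"
    using assms unfolding hardy2_def by blast
  define b where "b = (\<lambda>q. a (fst q) (snd q))"
  have hs: "((\<lambda>q. b q * bimonom q p) has_sum f p) UNIV" if "p \<in> bidisc" for p
    using a(1) bidisc_powser_iff[of b f] that by (simp add: b_def)
  then have cb: "coef f = b" by (rule coef_eqI)
  show s: "sq_summable (coef f)" using a(2) by (simp add: cb b_def sq_summable_def case_prod_unfold)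
  show "of_coef (coef f) = f"
    using hs f0 by (auto simp: cb of_coef_def fun_eq_iff infsumI)
qed

lemma hardy2_has_sum:
  assumes "f \<in> hardy2" "p \<in> bidisc"
  shows "((\<lambda>q. coef f q * bimonom q p) has_sum f p) UNIV"
  using of_coef_has_sum[OF hardy2_obtain_coef(1)[OF assms(1)] assms(2)] hardy2_obtain_coef(2)[OF assms(1)]
  by simp

lemma hardy2_outside: "f \<in> hardy2 \<Longrightarrow> p \<notin> bidisc \<Longrightarrow> f p = 0"
  unfolding hardy2_def by blast

lemma hardy2_eqI:
  assumes "f \<in> hardy2" "g \<in> hardy2" "\<And>p. p \<in> bidisc \<Longrightarrow> f p = g p"
  shows "f = g"
  using assms hardy2_outside by (auto simp: fun_eq_iff) metis

lemma hardy2_coefI: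
  assumes "sq_summable a" "\<And>p. p \<in> bidisc \<Longrightarrow> ((\<lambda>q. a q * bimonom q p) has_sum f p) UNIV"
    and "\<And>p. p \<notin> bidisc \<Longrightarrow> f p = 0"
  shows "f \<in> hardy2" and "coef f = a"
proof -
  show "coef f = a" using assms(2) by (rule coef_eqI)
  have "f p = of_coef a p" for p
    using assms(2)[of p, THEN infsumI] assms(3)[of p] by (auto simp: of_coef_def)
  then have "f = of_coef a" by (rule ext)
  then show "f \<in> hardy2" using of_coef_hardy2[OF assms(1)] by simp
qed

lemma hardy2_add:
  assumes "f \<in> hardy2" "g \<in> hardy2"
  shows "(\<lambda>p. f p + g p) \<in> hardy2" and "coef (\<lambda>p. f p + g p) = (\<lambda>q. coef f q + coef g q)"
proof -
  have "((\<lambda>q. (coef f q + coef g q) * bimonom q p) has_sum (f p + g p)) UNIV" if "p \<in> bidisc" for p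
    using has_sum_add[OF assms[THEN hardy2_has_sum, OF that]] by (simp add: distrib_right)
  from hardy2_coefI[OF sq_summable_add this] assms show
    "(\<lambda>p. f p + g p) \<in> hardy2" "coef (\<lambda>p. f p + g p) = (\<lambda>q. coef f q + coef g q)"
    by (simp_all add: hardy2_outside hardy2_obtain_coef)
qed

lemma hardy2_cmult:
  assumes "f \<in> hardy2"
  shows "(\<lambda>p. c * f p) \<in> hardy2" and "coef (\<lambda>p. c * f p) = (\<lambda>q. c * coef f q)"
proof -
  have "((\<lambda>q. (c * coef f q) * bimonom q p) has_sum (c * f p)) UNIV" if "p \<in> bidisc" for p
    using has_sum_cmult_right[OF assms[THEN hardy2_has_sum, OF that]] by (simp add: mult.assoc)
  from hardy2_coefI[OF sq_summable_cmult this] assms show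
    "(\<lambda>p. c * f p) \<in> hardy2" "coef (\<lambda>p. c * f p) = (\<lambda>q. c * coef f q)"
    by (simp_all add: hardy2_outside hardy2_obtain_coef)
qed

lemma hardy2_zero: "(\<lambda>p. 0) \<in> hardy2"
  using hardy2_coefI(1)[of "\<lambda>_. 0" "\<lambda>_. 0"] by (simp add: sq_summable_def)

lemma hardy2_uminus: "f \<in> hardy2 \<Longrightarrow> (\<lambda>p. - f p) \<in> hardy2"
  using hardy2_cmult(1)[of f "-1"] by simp

lemma hardy2_diff: "f \<in> hardy2 \<Longrightarrow> g \<in> hardy2 \<Longrightarrow> (\<lambda>p. f p - g p) \<in> hardy2"
  using hardy2_add(1)[of f "\<lambda>p. - g p"] by (simp add: hardy2_uminus)

lemma hardy2_sum:
  assumes "finite F" "\<And>i. i \<in> F \<Longrightarrow> f i \<in> hardy2"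
  shows "(\<lambda>p. \<Sum>i\<in>F. f i p) \<in> hardy2"
  using assms by (induction F) (auto simp: hardy2_zero intro!: hardy2_add)

section \<open>The inner product\<close>

lemma hinner_alt: "hinner f g = (\<Sum>\<^sub>\<infinity>q. coef f q * cnj (coef g q))"
  by (simp add: hinner_def coef_def case_prod_unfold)

lemma hinner_summable:
  "f \<in> hardy2 \<Longrightarrow> g \<in> hardy2 \<Longrightarrow> (\<lambda>q. coef f q * cnj (coef g q)) summable_on UNIV"
  by (intro sq_summable_inner hardy2_obtain_coef)

lemma hinner_cnj: "hinner g f = cnj (hinner f g)"
  unfolding hinner_alt by (subst infsum_cnj[symmetric]) (simp add: mult.commute)

lemma hinner_add_left:
  "f \<in> hardy2 \<Longrightarrow> g \<in> hardy2 \<Longrightarrow> h \<in> hardy2 \<Longrightarrow>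
    hinner (\<lambda>p. f p + g p) h = hinner f h + hinner g h"
  by (simp add: hinner_alt hardy2_add distrib_right infsum_add hinner_summable)

lemma hinner_cmult_left: "f \<in> hardy2 \<Longrightarrow> hinner (\<lambda>p. c * f p) h = c * hinner f h"
  by (simp add: hinner_alt hardy2_cmult mult.assoc infsum_cmult_right')

lemma hinner_diff_left:
  assumes "f \<in> hardy2" "g \<in> hardy2" "h \<in> hardy2"
  shows "hinner (\<lambda>p. f p - g p) h = hinner f h - hinner g h"
  using hinner_add_left[OF assms(1) hardy2_cmult(1)[OF assms(2), of "-1"] assms(3)]
    hinner_cmult_left[OF assms(2), of "-1" h] by simp

lemma hinner_zero_left: "hinner (\<lambda>p. 0) h = 0"
  using hinner_cmult_left[OF hardy2_zero, of 0 h] by simp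

lemma hinner_cmult_right: "f \<in> hardy2 \<Longrightarrow> hinner h (\<lambda>p. c * f p) = cnj c * hinner h f"
  using hinner_cmult_left[of f c h] by (metis complex_cnj_mult hinner_cnj)

lemma hinner_diff_right:
  "f \<in> hardy2 \<Longrightarrow> g \<in> hardy2 \<Longrightarrow> h \<in> hardy2 \<Longrightarrow>
    hinner h (\<lambda>p. f p - g p) = hinner h f - hinner h g"
  using hinner_diff_left[of f g h] by (metis complex_cnj_diff hinner_cnj)

lemma hinner_zero_right: "hinner h (\<lambda>p. 0) = 0"
  using hinner_zero_left[of h] hinner_cnj[of h] by simp

lemma hinner_sum_left:
  assumes "finite F" "\<And>i. i \<in> F \<Longrightarrow> f i \<in> hardy2" "h \<in> hardy2"
  shows "hinner (\<lambda>p. \<Sum>i\<in>F. f i p) h = (\<Sum>i\<in>F. hinner (f i) h)"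
  using assms by (induction F) (auto simp: hinner_zero_left hinner_add_left hardy2_sum)

definition norm2 :: "(complex \<times> complex \<Rightarrow> complex) \<Rightarrow> real" where
  "norm2 f = (\<Sum>\<^sub>\<infinity>q. (cmod (coef f q))\<^sup>2)"

lemma hinner_self: "f \<in> hardy2 \<Longrightarrow> hinner f f = of_real (norm2 f)"
  unfolding hinner_alt norm2_def
  using has_sum_of_real[OF has_sum_infsum[OF hardy2_obtain_coef(1)[unfolded sq_summable_def]], of f, where ?'a = complex]
  by (simp only: complex_norm_square infsumI)

lemma norm2_nonneg: "norm2 f \<ge> 0"
  by (simp add: norm2_def infsum_nonneg)

lemma norm2_eq_0:
  assumes "f \<in> hardy2" "norm2 f = 0"
  shows "f = (\<lambda>p. 0)"
proof -
  have "(cmod (coef f q))\<^sup>2 = 0" for q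
    using assms by (intro nonneg_infsum_le_0D[of _ UNIV]) (auto simp: norm2_def hardy2_obtain_coef(1)[unfolded sq_summable_def])
  then have "coef f q = 0" for q by simp
  then have "of_coef (coef f) = (\<lambda>p. 0)" by (simp add: of_coef_def fun_eq_iff del: split_paired_All)
  then show ?thesis using hardy2_obtain_coef(2)[OF assms(1)] by simp
qed

lemma hinner_self_eq_0: "f \<in> hardy2 \<Longrightarrow> hinner f f = 0 \<Longrightarrow> f = (\<lambda>p. 0)"
  using norm2_eq_0[of f] by (simp add: hinner_self)

lemma hardy2_eq_if_hinner_eq:
  assumes "f \<in> hardy2" "g \<in> hardy2" "\<And>h. h \<in> hardy2 \<Longrightarrow> hinner h f = hinner h g"
  shows "f = g"
proof -
  have "hinner (\<lambda>p. f p - g p) (\<lambda>p. f p - g p) = 0"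
    using assms(3)[of "\<lambda>p. f p - g p"] assms(1,2) by (simp add: hinner_diff_right hardy2_diff)
  from hinner_self_eq_0[OF _ this] assms(1,2) show ?thesis by (simp add: hardy2_diff fun_eq_iff)
qed

lemma norm2_diff:
  assumes "f \<in> hardy2" "g \<in> hardy2"
  shows "norm2 (\<lambda>p. f p - c * g p) = norm2 f - 2 * Re (cnj c * hinner f g) + (cmod c)\<^sup>2 * norm2 g"
proof -
  have "hinner (\<lambda>p. f p - c * g p) (\<lambda>p. f p - c * g p) =
      hinner f f - cnj c * hinner f g - c * cnj (hinner f g) + c * cnj c * hinner g g"
    using assms
    by (simp add: hinner_diff_left hinner_diff_right hardy2_diff hardy2_cmult hinner_cmult_left
        hinner_cmult_right hinner_cnj[of g f] algebra_simps)
  also have "c * cnj c = of_real ((cmod c)\<^sup>2)" by (rule complex_norm_square[symmetric])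
  finally have "of_real (norm2 (\<lambda>p. f p - c * g p)) = of_real (norm2 f) - cnj c * hinner f g
     - c * cnj (hinner f g) + of_real ((cmod c)\<^sup>2) * of_real (norm2 g)"
    using assms by (simp add: hinner_self hardy2_diff hardy2_cmult)
  from arg_cong[OF this, of Re] show ?thesis by simp
qed

lemma hinner_Cauchy_Schwarz:
  assumes "f \<in> hardy2" "g \<in> hardy2"
  shows "(cmod (hinner f g))\<^sup>2 \<le> norm2 f * norm2 g"
proof (cases "norm2 g = 0")
  case True
  then show ?thesis using norm2_eq_0[OF assms(2)] by (simp add: hinner_zero_right)
next
  case False
  then have g: "norm2 g > 0" using norm2_nonneg[of g] by simp
  define c where "c = hinner f g / of_real (norm2 g)"
  have "cnj c * hinner f g = of_real ((cmod (hinner f g))\<^sup>2 / norm2 g)"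
    by (simp only: complex_norm_square of_real_divide c_def complex_cnj_divide complex_cnj_complex_of_real)
      (simp add: mult.commute)
  moreover have "(cmod c)\<^sup>2 * norm2 g = (cmod (hinner f g))\<^sup>2 / norm2 g"
    using g by (simp add: c_def norm_divide power_divide power2_eq_square)
  ultimately have "norm2 (\<lambda>p. f p - c * g p) = norm2 f - (cmod (hinner f g))\<^sup>2 / norm2 g"
    using norm2_diff[OF assms, of c] by simp
  then have "(cmod (hinner f g))\<^sup>2 / norm2 g \<le> norm2 f" using norm2_nonneg[of "\<lambda>p. f p - c * g p"] by simp
  then show ?thesis using g by (simp add: pos_divide_le_eq)
qed

section \<open>Monomials, reproducing kernels and Riesz representation\<close>

text \<open>The monomials, set to zero off the bidisc like all elements of \<open>hardy2\<close>; they form the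
  orthonormal basis that the coefficients refer to.\<close>

definition emon :: "nat \<times> nat \<Rightarrow> complex \<times> complex \<Rightarrow> complex" where
  "emon q p = (if p \<in> bidisc then bimonom q p else 0)"

lemma sq_summable_delta: "sq_summable (\<lambda>q'. if q' = q then c else 0)"
  unfolding sq_summable_def
  by (rule finite_nonzero_values_imp_summable_on) (rule finite_subset[of _ "{q}"], auto)

lemma emon_hardy2: "emon q \<in> hardy2"
  and coef_emon: "coef (emon q) = (\<lambda>q'. if q' = q then 1 else 0)"
proof -
  have "((\<lambda>q'. (if q' = q then 1 else 0) * bimonom q' p) has_sum emon q p) UNIV"
    if "p \<in> bidisc" for p
    by (rule has_sum_finite_neutralI[of "{q}"]) (auto simp: emon_def that)
  note * = hardy2_coefI[OF sq_summable_delta this]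
  show "emon q \<in> hardy2" by (rule *(1)) (simp_all add: emon_def)
  show "coef (emon q) = (\<lambda>q'. if q' = q then 1 else 0)" by (rule *(2)) (simp_all add: emon_def)
qed

lemma infsum_delta: "(\<Sum>\<^sub>\<infinity>q'. f q' * (if q' = q then 1 else 0)) = (f q :: complex)"
proof -
  have "((\<lambda>q'. f q' * (if q' = q then 1 else 0)) has_sum f q) UNIV"
    by (rule has_sum_finite_neutralI[of "{q}"]) auto
  then show ?thesis by (rule infsumI)
qed

lemma hinner_emon: "hinner f (emon q) = coef f q"
proof -
  have "cnj (if q' = q then 1 else 0) = (if q' = q then 1 else 0)" for q' by simp
  then show ?thesis using infsum_delta[of "coef f" q] by (simp only: hinner_alt coef_emon)
qed

text \<open>The reproducing kernel (Szego kernel) at \<open>p\<close>, given by its coefficients.\<close>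

definition kern :: "complex \<times> complex \<Rightarrow> complex \<times> complex \<Rightarrow> complex" where
  "kern p = of_coef (\<lambda>q. cnj (bimonom q p))"

lemma kern_hardy2: "p \<in> bidisc \<Longrightarrow> kern p \<in> hardy2"
  unfolding kern_def by (intro of_coef_hardy2 sq_summable_cnj sq_summable_bimonom)

lemma coef_kern: "p \<in> bidisc \<Longrightarrow> coef (kern p) = (\<lambda>q. cnj (bimonom q p))"
  unfolding kern_def by (intro coef_of_coef sq_summable_cnj sq_summable_bimonom)

lemma hinner_kern: "f \<in> hardy2 \<Longrightarrow> p \<in> bidisc \<Longrightarrow> hinner f (kern p) = f p"
  by (simp add: hinner_alt coef_kern infsumI[OF hardy2_has_sum])

lemma norm2_finite_support:
  assumes "finite F"
  shows "norm2 (\<lambda>p. \<Sum>q\<in>F. c q * emon q p) = (\<Sum>q\<in>F. (cmod (c q))\<^sup>2)"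
    and "coef (\<lambda>p. \<Sum>q\<in>F. c q * emon q p) = (\<lambda>q. if q \<in> F then c q else 0)"
    and "(\<lambda>p. \<Sum>q\<in>F. c q * emon q p) \<in> hardy2"
proof -
  show h: "(\<lambda>p. \<Sum>q\<in>F. c q * emon q p) \<in> hardy2"
    using assms by (intro hardy2_sum hardy2_cmult emon_hardy2)
  show c: "coef (\<lambda>p. \<Sum>q\<in>F. c q * emon q p) = (\<lambda>q. if q \<in> F then c q else 0)"
  proof
    fix q
    have "hinner (\<lambda>p. \<Sum>q\<in>F. c q * emon q p) (emon q) = (\<Sum>q'\<in>F. c q' * hinner (emon q') (emon q))"
      using assms by (simp only: hinner_sum_left hardy2_cmult emon_hardy2 hinner_cmult_left)
    also have "\<dots> = (\<Sum>q'\<in>F. if q' = q then c q' else 0)"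
      by (intro sum.cong) (auto simp: hinner_emon coef_emon)
    finally have "hinner (\<lambda>p. \<Sum>q\<in>F. c q * emon q p) (emon q) = (\<Sum>q'\<in>F. if q' = q then c q' else 0)" .
    then show "coef (\<lambda>p. \<Sum>q\<in>F. c q * emon q p) q = (if q \<in> F then c q else 0)"
      using assms by (simp add: hinner_emon)
  qed
  have "((\<lambda>q. (cmod (if q \<in> F then c q else 0))\<^sup>2) has_sum (\<Sum>q\<in>F. (cmod (c q))\<^sup>2)) UNIV"
    using assms by (intro has_sum_finite_neutralI[of F]) auto
  then show "norm2 (\<lambda>p. \<Sum>q\<in>F. c q * emon q p) = (\<Sum>q\<in>F. (cmod (c q))\<^sup>2)"
    unfolding norm2_def c by (rule infsumI)
qed

text \<open>The candidate has the coefficients \<open>cnj (L (emon q))\<close>. Testing \<open>L\<close> on a finite section \<open>s\<close> of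
  the candidate gives \<open>L s = norm2 s\<close>, so boundedness of \<open>L\<close> bounds the square sum of
  the coefficients by \<open>C\<close>.\<close>

lemma Riesz_representation:
  assumes add: "\<And>f g. f \<in> hardy2 \<Longrightarrow> g \<in> hardy2 \<Longrightarrow> L (\<lambda>p. f p + g p) = L f + L g"
    and cmult: "\<And>c f. f \<in> hardy2 \<Longrightarrow> L (\<lambda>p. c * f p) = c * L f"
    and bound: "\<And>f. f \<in> hardy2 \<Longrightarrow> (cmod (L f))\<^sup>2 \<le> C * norm2 f"
  shows "\<exists>g\<in>hardy2. \<forall>f\<in>hardy2. L f = hinner f g"
proof -
  define c where "c q = cnj (L (emon q))" for q
  have L_sum: "L (\<lambda>p. \<Sum>q\<in>F. d q * emon q p) = (\<Sum>q\<in>F. d q * L (emon q))" if "finite F" for F d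
    using that
  proof (induction F)
    case empty
    show ?case using cmult[OF hardy2_zero, of 0] by simp
  next
    case (insert q F)
    have "(\<lambda>p. \<Sum>q\<in>insert q F. d q * emon q p) = (\<lambda>p. d q * emon q p + (\<Sum>q\<in>F. d q * emon q p))"
      using insert by simp
    then show ?case
      using insert by (simp add: add cmult hardy2_cmult emon_hardy2 norm2_finite_support(3))
  qed
  have fin: "(\<Sum>q\<in>F. (cmod (c q))\<^sup>2) \<le> C" if "finite F" for F
  proof -
    let ?s = "\<Sum>q\<in>F. (cmod (c q))\<^sup>2"
    have "L (\<lambda>p. \<Sum>q\<in>F. c q * emon q p) = (\<Sum>q\<in>F. c q * cnj (c q))"
      using that by (simp add: L_sum c_def)
    also have "\<dots> = of_real ?s" by (simp only: complex_norm_square of_real_sum)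
    finally have "?s\<^sup>2 \<le> C * ?s"
      using bound[OF norm2_finite_support(3)[OF that, of c]] norm2_finite_support(1)[OF that, of c]
      by (simp del: of_real_sum)
    moreover have "?s \<ge> 0" by (simp add: sum_nonneg)
    moreover have "C \<ge> 0"
      using bound[OF emon_hardy2[of "(0,0)"]] norm2_finite_support(1)[of "{(0,0)}" "\<lambda>_. 1"]
      by simp (smt (verit) zero_le_power2)
    ultimately show ?thesis
      by (cases "?s = 0") (auto simp: power2_eq_square)
  qed
  have sc: "sq_summable c"
    unfolding sq_summable_def
    by (rule nonneg_bounded_partial_sums_imp_summable_on[of _ _ C])
      (auto simp: eventually_finite_subsets_at_top fin)
  define g where "g = of_coef c"
  have g: "g \<in> hardy2" "coef g = c" using sc by (auto simp: g_def of_coef_hardy2 coef_of_coef)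
  have "L f = hinner f g" if f: "f \<in> hardy2" for f
  proof -
    \<comment> \<open>Both sides are continuous and agree on the finite sections of \<open>f\<close>.\<close>
    define s where "s F p = (\<Sum>q\<in>F. coef f q * emon q p)" for F p
    have "((\<lambda>F. \<Sum>q\<in>F. (cmod (coef f q))\<^sup>2) \<longlongrightarrow> norm2 f) (finite_subsets_at_top UNIV)"
      using has_sum_infsum[OF hardy2_obtain_coef(1)[OF f, unfolded sq_summable_def]]
      unfolding has_sum_def norm2_def .
    then have lim0: "((\<lambda>F. C * (norm2 f - (\<Sum>q\<in>F. (cmod (coef f q))\<^sup>2))) \<longlongrightarrow> C * (norm2 f - norm2 f))
        (finite_subsets_at_top UNIV)"
      by (intro tendsto_intros)
    have "(cmod (L f - (\<Sum>q\<in>F. coef f q * cnj (c q))))\<^sup>2 \<le> C * (norm2 f - (\<Sum>q\<in>F. (cmod (coef f q))\<^sup>2))"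
      if F: "finite F" for F
    proof -
      have sF: "s F \<in> hardy2" using norm2_finite_support(3)[OF F] by (simp add: s_def[abs_def])
      have "hinner f (s F) = (\<Sum>q\<in>F. coef f q * cnj (coef f q))"
        using F f unfolding s_def[abs_def]
        by (subst hinner_cnj) (simp add: hinner_sum_left hardy2_cmult emon_hardy2 hinner_cmult_left
            hinner_cnj[of "emon _"] hinner_emon mult.commute)
      also have "\<dots> = of_real (\<Sum>q\<in>F. (cmod (coef f q))\<^sup>2)" by (simp only: complex_norm_square of_real_sum)
      finally have "norm2 (\<lambda>p. f p - 1 * s F p) = norm2 f - (\<Sum>q\<in>F. (cmod (coef f q))\<^sup>2)"
        using norm2_diff[OF f sF, of 1] norm2_finite_support(1)[OF F, of "coef f"]
        by (simp add: s_def[abs_def] del: of_real_sum)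
      moreover have "L (\<lambda>p. f p - s F p) = L f - (\<Sum>q\<in>F. coef f q * cnj (c q))"
        using add[OF f hardy2_cmult(1)[OF sF, of "-1"]] cmult[OF sF, of "-1"] L_sum[OF F, of "coef f"]
        by (simp add: s_def[abs_def] c_def)
      ultimately show ?thesis
        using bound[OF hardy2_diff[OF f sF]] by simp
    qed
    then have "((\<lambda>F. (cmod (L f - (\<Sum>q\<in>F. coef f q * cnj (c q))))\<^sup>2) \<longlongrightarrow> 0) (finite_subsets_at_top UNIV)"
      by (intro tendsto_sandwich[OF _ _ tendsto_const lim0[simplified]])
        (auto simp: eventually_finite_subsets_at_top)
    then have "((\<lambda>F. sqrt ((cmod (L f - (\<Sum>q\<in>F. coef f q * cnj (c q))))\<^sup>2)) \<longlongrightarrow> sqrt 0) (finite_subsets_at_top UNIV)"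
      by (rule tendsto_real_sqrt)
    then have "((\<lambda>F. L f - (\<Sum>q\<in>F. coef f q * cnj (c q))) \<longlongrightarrow> 0) (finite_subsets_at_top UNIV)"
      by (simp add: tendsto_norm_zero_iff)
    from tendsto_diff[OF tendsto_const[of "L f"] this]
    have "((\<lambda>q. coef f q * cnj (c q)) has_sum L f) UNIV" by (simp add: has_sum_def)
    then show ?thesis by (simp add: hinner_alt g infsumI)
  qed
  with g show ?thesis by blast
qed

section \<open>Coefficients of inner functions\<close>

abbreviation circle_param :: "real measure" where
  "circle_param \<equiv> lebesgue_on {0..2 * pi}"

lemma integral_cis:
  "(LINT t|circle_param. cis (of_int j * t)) = (if j = 0 then of_real (2 * pi) else 0)"
proof -
  have "((\<lambda>t. cis (of_int j * t)) has_integral (if j = 0 then of_real (2 * pi) else 0)) {0..2 * pi}"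
  proof (cases "j = 0")
    case True
    then show ?thesis using has_integral_const_real[of "1::complex" 0 "2 * pi"] by (simp add: scaleR_conv_of_real)
  next
    case False
    define c where "c = \<i> * of_int j"
    have c: "c \<noteq> 0" using False by (simp add: c_def)
    have "((\<lambda>t. exp (c * of_real t) / c) has_vector_derivative cis (of_int j * t)) (at t within {0..2 * pi})" for t
    proof -
      have "((\<lambda>z. exp (c * z) / c) has_field_derivative exp (c * of_real t)) (at (of_real t))"
        using c by (auto intro!: derivative_eq_intros)
      from has_vector_derivative_real_field[OF this]
      show ?thesis by (simp add: cis_conv_exp c_def mult_ac)
    qed
    then have "((\<lambda>t. cis (of_int j * t)) has_integral (exp (c * of_real (2 * pi)) / c - exp (c * of_real 0) / c)) {0..2 * pi}"
      by (intro fundamental_theorem_of_calculus) auto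
    moreover have "exp (c * of_real (2 * pi)) = 1"
      using exp_integer_2pi[of "of_int j"] by (simp add: c_def mult_ac)
    ultimately show ?thesis using False by simp
  qed
  moreover have "integrable circle_param (\<lambda>t. cis (of_int j * t))"
    by (intro continuous_imp_integrable_real continuous_intros)
  ultimately show ?thesis
    using lebesgue_integral_eq_integral[of "{0..2 * pi}" "\<lambda>t. cis (of_int j * t)"] by (simp add: integral_unique)
qed

text \<open>The series converges absolutely and uniformly on the circle of radius \<open>r < 1\<close>, so it may be
  integrated term by term.\<close>

lemma circle_integral_power_series:
  fixes s :: "nat \<Rightarrow> complex"
  assumes sums: "\<And>z. cmod z < 1 \<Longrightarrow> (\<lambda>n. s n * z ^ n) sums \<theta> z"
    and r: "0 \<le> r" "r < 1" and G: "continuous_on {0..2 * pi} G"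
  shows "(\<lambda>n. s n * of_real r ^ n * (LINT t|circle_param. cis (of_int (int n) * t) * G t))
     sums (LINT t|circle_param. \<theta> (of_real r * cis t) * G t)"
proof -
  have summable: "summable (\<lambda>n. cmod (s n) * r ^ n)"
  proof -
    obtain x where x: "r < x" "x < 1" using r dense by blast
    have "summable (\<lambda>n. norm (s n * of_real r ^ n))"
      by (rule powser_insidea[of s "of_real x"])
        (use x r sums[of "of_real x"] in \<open>auto simp: sums_summable\<close>)
    then show ?thesis using r by (simp add: norm_mult norm_power)
  qed
  define f where "f n t = s n * of_real r ^ n * (cis (of_int (int n) * t) * G t)" for n t
  have "(\<lambda>n. integral\<^sup>L circle_param (f n)) sums (LINT t|circle_param. (\<Sum>n. f n t))"
  proof (rule sums_integral)
    show "integrable circle_param (f n)" for n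
      unfolding f_def by (intro continuous_imp_integrable_real continuous_intros G)
    have nf: "norm (f n t) = cmod (s n) * r ^ n * norm (G t)" for n t
      using r by (simp add: f_def norm_mult norm_power)
    show "AE t in circle_param. summable (\<lambda>n. norm (f n t))"
      by (simp add: nf summable summable_mult2)
    show "summable (\<lambda>n. LINT t|circle_param. norm (f n t))"
      by (simp add: nf summable summable_mult2)
  qed
  moreover have "(\<Sum>n. f n t) = \<theta> (of_real r * cis t) * G t" for t
  proof -
    have "(\<lambda>n. s n * (of_real r * cis t) ^ n * G t) sums (\<theta> (of_real r * cis t) * G t)"
      using r by (intro sums_mult2 sums) (simp add: norm_mult)
    moreover have "s n * (of_real r * cis t) ^ n * G t = f n t" for n
      by (simp add: f_def power_mult_distrib Complex.DeMoivre)
    ultimately show ?thesis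
      by (simp add: sums_iff)
  qed
  moreover have "integral\<^sup>L circle_param (f n) =
      s n * of_real r ^ n * (LINT t|circle_param. cis (of_int (int n) * t) * G t)" for n
    by (simp add: f_def[abs_def])
  ultimately show ?thesis by (simp only:)
qed

lemma circle_integral_coeff:
  fixes s :: "nat \<Rightarrow> complex"
  assumes sums: "\<And>z. cmod z < 1 \<Longrightarrow> (\<lambda>n. s n * z ^ n) sums \<theta> z"
    and r: "0 \<le> r" "r < 1"
  shows "(LINT t|circle_param. \<theta> (of_real r * cis t) * cis (of_int j * t)) =
     (if j \<le> 0 then 2 * pi * (s (nat (- j)) * of_real r ^ nat (- j)) else 0)"
proof -
  have "(\<lambda>n. s n * of_real r ^ n * (LINT t|circle_param. cis (of_int (int n) * t) * cis (of_int j * t)))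
     sums (LINT t|circle_param. \<theta> (of_real r * cis t) * cis (of_int j * t))"
    by (intro circle_integral_power_series sums r continuous_intros)
  moreover have "(LINT t|circle_param. cis (of_int (int n) * t) * cis (of_int j * t)) =
      (if n = nat (- j) \<and> j \<le> 0 then of_real (2 * pi) else 0)" for n
  proof -
    have "cis (of_int (int n) * t) * cis (of_int j * t) = cis (of_int (int n + j) * t)" for t
      by (simp add: cis_mult distrib_right)
    moreover have "int n + j = 0 \<longleftrightarrow> n = nat (- j) \<and> j \<le> 0" by auto
    ultimately show ?thesis by (simp only: integral_cis)
  qed
  ultimately have *: "(\<lambda>n. s n * of_real r ^ n * (if n = nat (- j) \<and> j \<le> 0 then of_real (2 * pi) else 0))
     sums (LINT t|circle_param. \<theta> (of_real r * cis t) * cis (of_int j * t))" by simp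
  have "(\<lambda>n. s n * of_real r ^ n * (if n = nat (- j) \<and> j \<le> 0 then of_real (2 * pi) else 0))
     sums (\<Sum>n\<in>{nat (- j)}. s n * of_real r ^ n * (if n = nat (- j) \<and> j \<le> 0 then of_real (2 * pi) else 0))"
    by (rule sums_finite) auto
  from sums_unique2[OF * this] show ?thesis by (simp add: mult_ac)
qed

text \<open>Parseval for the product of \<open>\<theta>\<close> with its conjugate, shifted by \<open>k\<close>: expanding the first factor reduces
  every term to a Fourier coefficient of the second one.\<close>

lemma circle_integral_autocorrelation:
  fixes s :: "nat \<Rightarrow> complex"
  assumes sums: "\<And>z. cmod z < 1 \<Longrightarrow> (\<lambda>n. s n * z ^ n) sums \<theta> z"
    and cont: "continuous_on (ball 0 1) \<theta>"
    and r: "0 \<le> r" "r < 1"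
  shows "(\<lambda>n. 2 * pi * (s (n + k) * cnj (s n) * of_real r ^ (2 * n + k))) sums
     (LINT t|circle_param. \<theta> (of_real r * cis t) * cnj (\<theta> (of_real r * cis t)) * cis (of_int (- int k) * t))"
proof -
  have c: "continuous_on {0..2 * pi} (\<lambda>t. \<theta> (of_real r * cis t))"
    by (rule continuous_on_compose2[OF cont]) (use r in \<open>auto intro!: continuous_intros simp: norm_mult\<close>)
  let ?G = "\<lambda>t. cnj (\<theta> (of_real r * cis t)) * cis (of_int (- int k) * t)"
  have "(\<lambda>n. s n * of_real r ^ n * (LINT t|circle_param. cis (of_int (int n) * t) * ?G t))
     sums (LINT t|circle_param. \<theta> (of_real r * cis t) * ?G t)"
    by (intro circle_integral_power_series sums r continuous_intros c)
  moreover have "(LINT t|circle_param. cis (of_int (int n) * t) * ?G t) =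
      (if k \<le> n then 2 * pi * (cnj (s (n - k)) * of_real r ^ (n - k)) else 0)" for n
  proof -
    have "cis (of_int (int n) * t) * ?G t = cnj (\<theta> (of_real r * cis t) * cis (of_int (int k - int n) * t))" for t
      by (simp add: cis_cnj mult_ac cis_mult algebra_simps)
    then have "(LINT t|circle_param. cis (of_int (int n) * t) * ?G t) =
        cnj (LINT t|circle_param. \<theta> (of_real r * cis t) * cis (of_int (int k - int n) * t))"
      by (simp only: Bochner_Integration.integral_cnj)
    moreover have "nat (int n - int k) = n - k" by simp
    ultimately show ?thesis
      using circle_integral_coeff[OF sums r, of "int k - int n"] by (auto simp: nat_diff_distrib)
  qed
  ultimately have *: "(\<lambda>n. s n * of_real r ^ n * (if k \<le> n then 2 * pi * (cnj (s (n - k)) * of_real r ^ (n - k)) else 0))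
     sums (LINT t|circle_param. \<theta> (of_real r * cis t) * ?G t)" (is "?f sums ?I") by (simp only:)
  have "(\<lambda>n. ?f (n + k)) sums ?I"
    using * by (subst sums_zero_iff_shift) auto
  moreover have "?f (n + k) = 2 * pi * (s (n + k) * cnj (s n) * of_real r ^ (2 * n + k))" for n
  proof -
    have "2 * n + k = (n + k) + n" by simp
    then show ?thesis by (simp only: power_add[of _ "n + k" n]) simp
  qed
  ultimately show ?thesis by (simp only: mult.assoc)
qed

text \<open>Letting \<open>r\<close> tend to \<open>1\<close> in \<open>circle_integral_autocorrelation\<close>: the boundary values have
  modulus one almost everywhere, so the integrals converge to those of the characters, while the
  series converge to the autocorrelation sums. The case \<open>k = 0\<close> comes first, because it
  supplies the square-summability that dominates the series.\<close>

lemma inner_function_coefficients: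
  assumes "inner_function \<theta>"
  obtains s where "\<And>z. cmod z < 1 \<Longrightarrow> ((\<lambda>n. s n * z ^ n) has_sum \<theta> z) UNIV"
    and "sq_summable s"
    and "\<And>k. (\<Sum>\<^sub>\<infinity>n. s (n + k) * cnj (s n)) = (if k = 0 then 1 else 0)"
proof -
  have hol: "\<theta> holomorphic_on ball 0 1" and bdd: "bounded (\<theta> ` ball 0 1)"
    and lim: "AE t in circle_param. \<exists>l. cmod l = 1 \<and> ((\<lambda>r. \<theta> (of_real r * cis t)) \<longlongrightarrow> l) (at_left 1)"
    using assms by (auto simp: inner_function_def)
  have cont: "continuous_on (ball 0 1) \<theta>" by (rule holomorphic_on_imp_continuous_on[OF hol])
  obtain C where C: "\<And>z. cmod z < 1 \<Longrightarrow> cmod (\<theta> z) \<le> C"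
    using bdd by (force simp: bounded_iff)
  define s where "s n = (deriv ^^ n) \<theta> 0 / fact n" for n
  have sums: "(\<lambda>n. s n * z ^ n) sums \<theta> z" if "cmod z < 1" for z
    using holomorphic_power_series[OF hol, of z] that by (simp add: s_def)
  have has_sum: "((\<lambda>n. s n * z ^ n) has_sum \<theta> z) UNIV" if z: "cmod z < 1" for z
  proof (rule norm_summable_imp_has_sum[OF _ sums[OF z]])
    obtain x where x: "cmod z < x" "x < 1" using z dense by blast
    then have "cmod (of_real x) = x" using norm_ge_zero[of z] by (simp del: norm_ge_zero)
    then show "summable (\<lambda>n. norm (s n * z ^ n))"
      using x by (intro powser_insidea[of s "of_real x"] sums_summable[OF sums]) auto
  qed
  have meas: "(\<lambda>t. \<theta> (of_real r * cis t) * cnj (\<theta> (of_real r * cis t)) * cis (of_int (- int k) * t))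
      \<in> borel_measurable circle_param" and
    int: "integrable circle_param (\<lambda>t. \<theta> (of_real r * cis t) * cnj (\<theta> (of_real r * cis t)) * cis (of_int (- int k) * t))"
    if "0 \<le> r" "r < 1" for r k
  proof -
    have "continuous_on {0..2 * pi} (\<lambda>t. \<theta> (of_real r * cis t))"
      by (rule continuous_on_compose2[OF cont]) (use that in \<open>auto intro!: continuous_intros simp: norm_mult\<close>)
    then have "continuous_on {0..2 * pi} (\<lambda>t. \<theta> (of_real r * cis t) * cnj (\<theta> (of_real r * cis t)) * cis (of_int (- int k) * t))"
      by (intro continuous_intros)
    from continuous_imp_integrable_real[OF this] show
      "integrable circle_param (\<lambda>t. \<theta> (of_real r * cis t) * cnj (\<theta> (of_real r * cis t)) * cis (of_int (- int k) * t))" .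
    then show "(\<lambda>t. \<theta> (of_real r * cis t) * cnj (\<theta> (of_real r * cis t)) * cis (of_int (- int k) * t))
      \<in> borel_measurable circle_param" by (rule borel_measurable_integrable)
  qed
  define R where "R j = 1 - inverse (real (Suc j))" for j :: nat
  have R: "0 \<le> R j" "R j < 1" for j by (auto simp: R_def inverse_le_1_iff)
  have R_lim: "R \<longlonglongrightarrow> 1" unfolding R_def using tendsto_diff[OF tendsto_const[of "1::real"] LIMSEQ_inverse_real_of_nat] by simp
  have R_left: "filterlim R (at_left 1) sequentially"
    unfolding filterlim_at using R(2) R_lim less_imp_neq[OF R(2)] by auto
  \<comment> \<open>By dominated convergence the means over circles of radius \<open>R j\<close> tend to the boundary mean.\<close>
  have I_lim: "(\<lambda>j. LINT t|circle_param. \<theta> (of_real (R j) * cis t) * cnj (\<theta> (of_real (R j) * cis t)) * cis (of_int (- int k) * t))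
      \<longlonglongrightarrow> (LINT t|circle_param. cis (of_int (- int k) * t))" for k
  proof (rule integral_dominated_convergence)
    show "(\<lambda>t. cis (of_int (- int k) * t)) \<in> borel_measurable circle_param"
      by (intro borel_measurable_integrable continuous_imp_integrable_real continuous_intros)
    show "(\<lambda>t. \<theta> (of_real (R j) * cis t) * cnj (\<theta> (of_real (R j) * cis t)) * cis (of_int (- int k) * t))
      \<in> borel_measurable circle_param" for j by (rule meas[OF R])
    show "integrable circle_param (\<lambda>_. C * C)"
      by (intro continuous_imp_integrable_real continuous_intros)
    show "AE t in circle_param. (\<lambda>j. \<theta> (of_real (R j) * cis t) * cnj (\<theta> (of_real (R j) * cis t)) * cis (of_int (- int k) * t))
        \<longlonglongrightarrow> cis (of_int (- int k) * t)"
      using lim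
    proof eventually_elim
      case (elim t)
      then obtain l where l: "cmod l = 1" "((\<lambda>r. \<theta> (of_real r * cis t)) \<longlongrightarrow> l) (at_left 1)" by blast
      have "(\<lambda>j. \<theta> (of_real (R j) * cis t)) \<longlonglongrightarrow> l" by (rule filterlim_compose[OF l(2) R_left])
      then have "(\<lambda>j. \<theta> (of_real (R j) * cis t) * cnj (\<theta> (of_real (R j) * cis t)) * cis (of_int (- int k) * t))
        \<longlonglongrightarrow> l * cnj l * cis (of_int (- int k) * t)" by (intro tendsto_intros)
      moreover have "l * cnj l = 1" using l(1) complex_norm_square[of l] by simp
      ultimately show ?case by simp
    qed
    show "AE t in circle_param. norm (\<theta> (of_real (R j) * cis t) * cnj (\<theta> (of_real (R j) * cis t)) * cis (of_int (- int k) * t)) \<le> C * C" for j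
    proof (intro AE_I2)
      fix t
      have "cmod (of_real (R j) * cis t) < 1" using R[of j] by (simp add: norm_mult)
      from C[OF this] show "norm (\<theta> (of_real (R j) * cis t) * cnj (\<theta> (of_real (R j) * cis t)) * cis (of_int (- int k) * t)) \<le> C * C"
        by (auto simp: norm_mult intro!: mult_mono order_trans[OF norm_ge_zero])
    qed
  qed
  have autocorr: "(\<lambda>n. s (n + k) * cnj (s n) * of_real (R j) ^ (2 * n + k)) sums
     ((LINT t|circle_param. \<theta> (of_real (R j) * cis t) * cnj (\<theta> (of_real (R j) * cis t)) * cis (of_int (- int k) * t)) / (2 * pi))" for j k
    using sums_divide[OF circle_integral_autocorrelation[OF sums cont R(1)[of j] R(2)[of j], of k], of "2 * pi"]
    by simp
  have two_pi: "complex_of_real (2 * pi) \<noteq> 0" by simp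
  have partial: "(\<Sum>n<N. (cmod (s n))\<^sup>2) \<le> C\<^sup>2" for N
  proof (rule LIMSEQ_le_const2)
    show "(\<lambda>j. \<Sum>n<N. (cmod (s n))\<^sup>2 * R j ^ (2 * n)) \<longlonglongrightarrow> (\<Sum>n<N. (cmod (s n))\<^sup>2)"
      using R_lim by (auto intro!: tendsto_eq_intros)
    have "(\<Sum>n<N. (cmod (s n))\<^sup>2 * R j ^ (2 * n)) \<le> C\<^sup>2" for j
    proof -
      let ?I = "LINT t|circle_param. \<theta> (of_real (R j) * cis t) * cnj (\<theta> (of_real (R j) * cis t)) * cis (of_int (- int 0) * t)"
      have "(\<lambda>n. complex_of_real ((cmod (s n))\<^sup>2 * R j ^ (2 * n))) sums (?I / (2 * pi))"
      proof -
        have "s (n + 0) * cnj (s n) * of_real (R j) ^ (2 * n + 0) = complex_of_real ((cmod (s n))\<^sup>2 * R j ^ (2 * n))" for n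
          by (simp add: complex_norm_square[symmetric])
        then show ?thesis using autocorr[of 0 j] by (simp only:)
      qed
      then have re: "(\<lambda>n. (cmod (s n))\<^sup>2 * R j ^ (2 * n)) sums Re (?I / (2 * pi))"
        using sums_Re[of "\<lambda>n. complex_of_real ((cmod (s n))\<^sup>2 * R j ^ (2 * n))"] by (simp only: Re_complex_of_real)
      have "cmod ?I \<le> (LINT t|circle_param. norm (\<theta> (of_real (R j) * cis t) * cnj (\<theta> (of_real (R j) * cis t)) * cis (of_int (- int 0) * t)))"
        by (rule integral_norm_bound)
      also have "\<dots> \<le> (LINT t|circle_param. C\<^sup>2)"
      proof (rule integral_mono)
        show "integrable circle_param (\<lambda>t. norm (\<theta> (of_real (R j) * cis t) * cnj (\<theta> (of_real (R j) * cis t)) * cis (of_int (- int 0) * t)))"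
          by (intro integrable_norm int R)
        show "integrable circle_param (\<lambda>_. C\<^sup>2)"
          by (intro continuous_imp_integrable_real continuous_intros)
        fix t
        have "cmod (of_real (R j) * cis t) < 1" using R[of j] by (simp add: norm_mult)
        from C[OF this] show "norm (\<theta> (of_real (R j) * cis t) * cnj (\<theta> (of_real (R j) * cis t)) * cis (of_int (- int 0) * t)) \<le> C\<^sup>2"
          by (auto simp: norm_mult power2_eq_square intro!: mult_mono order_trans[OF norm_ge_zero])
      qed
      also have "\<dots> = 2 * pi * C\<^sup>2"
        by (simp add: measure_restrict_space)
      finally have "cmod (?I / (2 * pi)) \<le> C\<^sup>2"
        by (simp add: norm_divide norm_mult field_simps)
      then have "Re (?I / (2 * pi)) \<le> C\<^sup>2" using complex_Re_le_cmod order_trans by blast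
      moreover have "(\<Sum>n<N. (cmod (s n))\<^sup>2 * R j ^ (2 * n)) \<le> Re (?I / (2 * pi))"
        using sum_le_suminf[OF sums_summable[OF re], of "{..<N}"] sums_unique[OF re] R by simp
      ultimately show ?thesis by simp
    qed
    then show "\<exists>M. \<forall>j\<ge>M. (\<Sum>n<N. (cmod (s n))\<^sup>2 * R j ^ (2 * n)) \<le> C\<^sup>2"
      by (intro exI[of _ 0] allI impI)
  qed
  have "summable (\<lambda>n. (cmod (s n))\<^sup>2)"
    by (rule summableI_nonneg_bounded[of _ "C\<^sup>2"]) (use partial in auto)
  then have sq: "sq_summable s"
    unfolding sq_summable_def by (intro summable_nonneg_imp_summable_on) auto
  have autocor: "(\<Sum>\<^sub>\<infinity>n. s (n + k) * cnj (s n)) = (if k = 0 then 1 else 0)" for k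
  proof -
    have "sq_summable (\<lambda>n. s (n + k))"
      unfolding sq_summable_def
      using summable_on_reindex[of "\<lambda>n. n + k" UNIV "\<lambda>n. (cmod (s n))\<^sup>2"]
        summable_on_subset[OF sq[unfolded sq_summable_def] subset_UNIV, of "range (\<lambda>n. n + k)"]
      by (simp add: o_def)
    then have son: "(\<lambda>n. s (n + k) * cnj (s n)) summable_on UNIV"
      using sq by (rule sq_summable_inner)
    then have "summable (\<lambda>n. norm (s (n + k) * cnj (s n)))"
      by (intro summable_on_imp_summable summable_on_iff_abs_summable_on_complex[THEN iffD1])
    then have "(\<lambda>j. \<Sum>n. s (n + k) * cnj (s n) * of_real (R j) ^ (2 * n + k)) \<longlonglongrightarrow> (\<Sum>n. s (n + k) * cnj (s n))"
    proof (rule tannerys_theorem[THEN conjunct2, THEN conjunct2, rotated 2])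
      show "(\<lambda>j. s (n + k) * cnj (s n) * of_real (R j) ^ (2 * n + k)) \<longlonglongrightarrow> s (n + k) * cnj (s n)" for n
        using tendsto_mult[OF tendsto_const[of "s (n + k) * cnj (s n)"]
            tendsto_power[OF tendsto_of_real[OF R_lim, where 'a = complex], of "2 * n + k"]] by simp
      have "norm (s (n + k) * cnj (s n) * of_real (R j) ^ (2 * n + k)) \<le> norm (s (n + k) * cnj (s n))" for n j
      proof -
        have "norm (complex_of_real (R j) ^ (2 * n + k)) \<le> 1"
          unfolding norm_power using R[of j] by (intro power_le_one) auto
        then show ?thesis unfolding norm_mult[of "s (n + k) * cnj (s n)"] by (intro mult_left_le) auto
      qed
      then show "\<forall>\<^sub>F (n, j) in sequentially \<times>\<^sub>F sequentially.
          norm (s (n + k) * cnj (s n) * of_real (R j) ^ (2 * n + k)) \<le> norm (s (n + k) * cnj (s n))"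
        by (intro always_eventually) auto
    qed auto
    moreover have "(\<lambda>j. \<Sum>n. s (n + k) * cnj (s n) * of_real (R j) ^ (2 * n + k)) \<longlonglongrightarrow>
        (LINT t|circle_param. cis (of_int (- int k) * t)) / (2 * pi)"
      using tendsto_divide[OF I_lim[of k] tendsto_const[of "complex_of_real (2 * pi)"] two_pi] autocorr[of k, THEN sums_unique]
      by (simp only:)
    ultimately have "(\<Sum>n. s (n + k) * cnj (s n)) = (LINT t|circle_param. cis (of_int (- int k) * t)) / (2 * pi)"
      by (rule LIMSEQ_unique)
    also have "\<dots> = (if k = 0 then 1 else 0)" unfolding integral_cis by simp
    finally show ?thesis
      using sums_unique[OF has_sum_imp_sums[OF has_sum_infsum[OF son]]] by (simp only:)
  qed
  show ?thesis by (rule that[of s]) (assumption | rule has_sum sq autocor)+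
qed

section \<open>Isometric multipliers\<close>

lemma hardy2_eq_coefI: "f \<in> hardy2 \<Longrightarrow> g \<in> hardy2 \<Longrightarrow> coef f = coef g \<Longrightarrow> f = g"
  by (metis hardy2_obtain_coef(2))

text \<open>The condition only speaks of the images of the basis. That \<open>u\<close> multiplies the whole of \<open>hardy2\<close>
  into itself isometrically is then a consequence (\<open>mult_hardy2\<close>, \<open>hinner_mult_mult\<close>).\<close>

definition isometric_multiplier :: "(complex \<times> complex \<Rightarrow> complex) \<Rightarrow> bool" where
  "isometric_multiplier u \<longleftrightarrow>
     (\<forall>q. (\<lambda>p. u p * emon q p) \<in> hardy2) \<and>
     (\<forall>q r. hinner (\<lambda>p. u p * emon q p) (\<lambda>p. u p * emon r p) = (if q = r then 1 else 0))"

text \<open>The adjoint of multiplication by \<open>u\<close>, written down before it is known that multiplication by \<open>u\<close>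
  preserves \<open>hardy2\<close>: its coefficients are square-summable by Bessel's inequality.\<close>

definition mult_adj ::
    "(complex \<times> complex \<Rightarrow> complex) \<Rightarrow> (complex \<times> complex \<Rightarrow> complex) \<Rightarrow> complex \<times> complex \<Rightarrow> complex" where
  "mult_adj u f = of_coef (\<lambda>q. hinner f (\<lambda>p. u p * emon q p))"

lemma Bessel_inequality:
  assumes f: "f \<in> hardy2" and e: "\<And>q. e q \<in> hardy2"
    and orth: "\<And>q r. hinner (e q) (e r) = (if q = r then 1 else 0)"
  shows "(\<lambda>q. (cmod (hinner f (e q)))\<^sup>2) summable_on UNIV"
    and "(\<Sum>\<^sub>\<infinity>q. (cmod (hinner f (e q)))\<^sup>2) \<le> norm2 f"
proof -
  have fin: "(\<Sum>q\<in>F. (cmod (hinner f (e q)))\<^sup>2) \<le> norm2 f" if F: "finite F" for F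
  proof -
    let ?s = "\<Sum>q\<in>F. (cmod (hinner f (e q)))\<^sup>2"
    define s where "s = (\<lambda>p. \<Sum>q\<in>F. hinner f (e q) * e q p)"
    have s: "s \<in> hardy2" unfolding s_def using F by (intro hardy2_sum hardy2_cmult e)
    have s_left: "hinner s h = (\<Sum>q\<in>F. hinner f (e q) * hinner (e q) h)" if "h \<in> hardy2" for h
      unfolding s_def using F that by (simp only: hinner_sum_left hardy2_cmult e hinner_cmult_left)
    have sf: "hinner s f = of_real ?s"
      by (simp only: s_left[OF f] hinner_cnj[of "e _" f] of_real_sum complex_norm_square)
    have "hinner (e r) s = cnj (hinner f (e r))" if "r \<in> F" for r
    proof -
      have "hinner s (e r) = (\<Sum>q\<in>F. if q = r then hinner f (e q) else 0)"
        unfolding s_left[OF e] orth by (intro sum.cong) auto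
      then show ?thesis using F that hinner_cnj[of "e r" s] by simp
    qed
    then have "hinner s s = (\<Sum>q\<in>F. hinner f (e q) * cnj (hinner f (e q)))"
      unfolding s_left[OF s] by (intro sum.cong) auto
    then have "hinner s s = of_real ?s"
      by (simp only: of_real_sum complex_norm_square)
    then have "norm2 s = ?s" using s by (simp add: hinner_self del: of_real_sum)
    moreover have "hinner f s = of_real ?s"
      using sf hinner_cnj[of f s] by (simp del: of_real_sum)
    ultimately have "norm2 (\<lambda>p. f p - 1 * s p) = norm2 f - ?s"
      using norm2_diff[OF f s, of 1] by (simp del: of_real_sum)
    then show ?thesis using norm2_nonneg[of "\<lambda>p. f p - 1 * s p"] by simp
  qed
  then show 1: "(\<lambda>q. (cmod (hinner f (e q)))\<^sup>2) summable_on UNIV"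
    by (intro nonneg_bounded_partial_sums_imp_summable_on[of _ _ "norm2 f"])
      (auto simp: eventually_finite_subsets_at_top)
  show "(\<Sum>\<^sub>\<infinity>q. (cmod (hinner f (e q)))\<^sup>2) \<le> norm2 f"
    using fin by (intro infsum_le_finite_sums 1)
qed

context
  fixes u :: "complex \<times> complex \<Rightarrow> complex"
  assumes u: "isometric_multiplier u"
begin

lemma mult_emon_hardy2: "(\<lambda>p. u p * emon q p) \<in> hardy2"
  using u unfolding isometric_multiplier_def by blast

lemma mult_emon_orthonormal:
  "hinner (\<lambda>p. u p * emon q p) (\<lambda>p. u p * emon r p) = (if q = r then 1 else 0)"
  using u unfolding isometric_multiplier_def by blast

lemma mult_adj_basic:
  assumes "f \<in> hardy2"
  shows mult_adj_hardy2: "mult_adj u f \<in> hardy2"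
    and coef_mult_adj: "coef (mult_adj u f) q = hinner f (\<lambda>p. u p * emon q p)"
    and norm2_mult_adj_le: "norm2 (mult_adj u f) \<le> norm2 f"
proof -
  note B = Bessel_inequality[OF assms mult_emon_hardy2 mult_emon_orthonormal]
  have sq: "sq_summable (\<lambda>q. hinner f (\<lambda>p. u p * emon q p))"
    using B(1) by (simp add: sq_summable_def)
  show "mult_adj u f \<in> hardy2" unfolding mult_adj_def by (rule of_coef_hardy2[OF sq])
  have c: "coef (mult_adj u f) = (\<lambda>q. hinner f (\<lambda>p. u p * emon q p))"
    unfolding mult_adj_def by (rule coef_of_coef[OF sq])
  then show "coef (mult_adj u f) q = hinner f (\<lambda>p. u p * emon q p)" by simp
  show "norm2 (mult_adj u f) \<le> norm2 f" using B(2) by (simp add: norm2_def c)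
qed

lemma mult_adj_add:
  assumes "f \<in> hardy2" "g \<in> hardy2"
  shows "mult_adj u (\<lambda>p. f p + g p) = (\<lambda>p. mult_adj u f p + mult_adj u g p)"
  using assms by (intro hardy2_eq_coefI ext)
    (simp_all add: hardy2_add mult_adj_hardy2 coef_mult_adj hinner_add_left mult_emon_hardy2)

lemma mult_adj_cmult:
  assumes "f \<in> hardy2"
  shows "mult_adj u (\<lambda>p. c * f p) = (\<lambda>p. c * mult_adj u f p)"
  using assms by (intro hardy2_eq_coefI ext)
    (simp_all add: hardy2_cmult mult_adj_hardy2 coef_mult_adj hinner_cmult_left)

lemma mult_adj_diff:
  assumes "f \<in> hardy2" "g \<in> hardy2"
  shows "mult_adj u (\<lambda>p. f p - g p) = (\<lambda>p. mult_adj u f p - mult_adj u g p)"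
  using mult_adj_add[OF assms(1) hardy2_cmult(1)[OF assms(2), of "-1"]] mult_adj_cmult[OF assms(2), of "-1"]
  by simp

text \<open>The reproducing kernels are eigenvectors of the adjoint; this is what identifies the adjoint
  of \<open>mult_adj u\<close> with pointwise multiplication.\<close>

lemma mult_adj_kern:
  assumes "p \<in> bidisc"
  shows "mult_adj u (kern p) = (\<lambda>x. cnj (u p) * kern p x)"
proof (rule hardy2_eq_coefI)
  show "coef (mult_adj u (kern p)) = coef (\<lambda>x. cnj (u p) * kern p x)"
  proof
    fix q
    have "hinner (kern p) (\<lambda>x. u x * emon q x) = cnj (u p * emon q p)"
      using hinner_kern[OF mult_emon_hardy2 assms] hinner_cnj by metis
    then show "coef (mult_adj u (kern p)) q = coef (\<lambda>x. cnj (u p) * kern p x) q"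
      using assms by (simp add: coef_mult_adj kern_hardy2 hardy2_cmult coef_kern emon_def)
  qed
qed (simp_all add: assms mult_adj_hardy2 kern_hardy2 hardy2_cmult)

text \<open>Let \<open>g\<close> represent the bounded functional that sends \<open>h\<close> to \<open>hinner (mult_adj u h) f\<close>. Evaluating at the
  kernel functions gives \<open>g p = u p * f p\<close>, so the product belongs to \<open>hardy2\<close>.\<close>

lemma mult_hardy2_and_adjoint:
  assumes f: "f \<in> hardy2"
  shows mult_hardy2: "(\<lambda>p. u p * f p) \<in> hardy2"
    and hinner_mult_right: "h \<in> hardy2 \<Longrightarrow> hinner h (\<lambda>p. u p * f p) = hinner (mult_adj u h) f"
proof -
  have "\<exists>g\<in>hardy2. \<forall>h\<in>hardy2. hinner (mult_adj u h) f = hinner h g"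
  proof (rule Riesz_representation[where C = "norm2 f"])
    show "(cmod (hinner (mult_adj u h) f))\<^sup>2 \<le> norm2 f * norm2 h" if h: "h \<in> hardy2" for h
    proof -
      have "(cmod (hinner (mult_adj u h) f))\<^sup>2 \<le> norm2 (mult_adj u h) * norm2 f"
        by (intro hinner_Cauchy_Schwarz mult_adj_hardy2 h f)
      also have "\<dots> \<le> norm2 h * norm2 f"
        by (intro mult_right_mono norm2_mult_adj_le h norm2_nonneg)
      finally show ?thesis by (simp add: mult.commute)
    qed
  qed (simp_all add: f mult_adj_add mult_adj_cmult hinner_add_left hinner_cmult_left mult_adj_hardy2)
  then obtain g where g: "g \<in> hardy2" "\<And>h. h \<in> hardy2 \<Longrightarrow> hinner (mult_adj u h) f = hinner h g" by blast
  have "u p * f p = g p" for p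
  proof (cases "p \<in> bidisc")
    case True
    have "cnj (g p) = hinner (kern p) g"
      using hinner_kern[OF g(1) True] hinner_cnj by metis
    also have "\<dots> = hinner (\<lambda>x. cnj (u p) * kern p x) f"
      using g(2)[OF kern_hardy2[OF True]] by (simp add: mult_adj_kern[OF True])
    also have "\<dots> = cnj (u p) * cnj (f p)"
      using hinner_kern[OF f True] hinner_cnj[of "kern p" f] by (simp add: hinner_cmult_left kern_hardy2 True)
    finally show ?thesis by (metis complex_cnj_cnj complex_cnj_mult)
  qed (simp add: f g hardy2_outside)
  then have "(\<lambda>p. u p * f p) = g" by (rule ext)
  with g show "(\<lambda>p. u p * f p) \<in> hardy2"
    and "h \<in> hardy2 \<Longrightarrow> hinner h (\<lambda>p. u p * f p) = hinner (mult_adj u h) f" by simp_all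
qed

lemma hinner_mult_left:
  assumes "f \<in> hardy2" "h \<in> hardy2"
  shows "hinner (\<lambda>p. u p * f p) h = hinner f (mult_adj u h)"
  using hinner_mult_right[OF assms] by (metis hinner_cnj)

lemma mult_adj_unique:
  assumes "f \<in> hardy2" "k \<in> hardy2" "\<And>h. h \<in> hardy2 \<Longrightarrow> hinner (\<lambda>p. u p * h p) f = hinner h k"
  shows "mult_adj u f = k"
  using assms by (intro hardy2_eq_if_hinner_eq mult_adj_hardy2) (simp_all flip: hinner_mult_left)

lemma mult_adj_mult_emon: "mult_adj u (\<lambda>p. u p * emon q p) = emon q"
  by (rule hardy2_eq_coefI)
    (auto simp: mult_adj_hardy2 emon_hardy2 mult_emon_hardy2 coef_mult_adj mult_emon_orthonormal coef_emon)

lemma mult_adj_mult: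
  assumes "f \<in> hardy2"
  shows "mult_adj u (\<lambda>p. u p * f p) = f"
proof (rule hardy2_eq_coefI)
  show "coef (mult_adj u (\<lambda>p. u p * f p)) = coef f"
    using assms by (auto simp: fun_eq_iff coef_mult_adj mult_hardy2 hinner_mult_left mult_emon_hardy2
        mult_adj_mult_emon hinner_emon)
qed (simp_all add: assms mult_hardy2 mult_adj_hardy2)

lemma hinner_mult_mult:
  assumes "f \<in> hardy2" "g \<in> hardy2"
  shows "hinner (\<lambda>p. u p * f p) (\<lambda>p. u p * g p) = hinner f g"
  using assms by (simp add: hinner_mult_left mult_hardy2 mult_adj_mult)

end

lemma isometric_multiplier_mult:
  assumes u: "isometric_multiplier u" and v: "isometric_multiplier v"
  shows "isometric_multiplier (\<lambda>p. u p * v p)"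
  unfolding isometric_multiplier_def
  by (auto simp: mult.assoc hinner_mult_mult[OF u] mult_hardy2[OF u] mult_emon_hardy2[OF v] mult_emon_orthonormal[OF v])

lemma mult_adj_mult_compose:
  assumes u: "isometric_multiplier u" and v: "isometric_multiplier v" and f: "f \<in> hardy2"
  shows "mult_adj (\<lambda>p. u p * v p) f = mult_adj v (mult_adj u f)"
  by (rule mult_adj_unique[OF isometric_multiplier_mult[OF u v] f])
    (simp_all add: mult.assoc mult_adj_hardy2 hinner_mult_left mult_hardy2 u v f)

lemma mult_adj_commute:
  assumes u: "isometric_multiplier u" and v: "isometric_multiplier v" and f: "f \<in> hardy2"
  shows "mult_adj u (mult_adj v f) = mult_adj v (mult_adj u f)"
  using mult_adj_mult_compose[OF assms] mult_adj_mult_compose[OF v u f] by (simp add: mult.commute)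

section \<open>Swapping the variables\<close>

lemma swap_bidisc: "prod.swap p \<in> bidisc \<longleftrightarrow> p \<in> bidisc"
  by (cases p) (auto simp: bidisc_def)

lemma bimonom_swap: "bimonom q (prod.swap p) = bimonom (prod.swap q) p"
  by (simp add: bimonom_def mult.commute)

lemma hardy2_swap:
  assumes "f \<in> hardy2"
  shows "(\<lambda>p. f (prod.swap p)) \<in> hardy2" and "coef (\<lambda>p. f (prod.swap p)) = (\<lambda>q. coef f (prod.swap q))"
proof -
  have bij: "bij_betw prod.swap UNIV (UNIV :: (nat \<times> nat) set)" by simp
  have sq: "sq_summable (\<lambda>q. coef f (prod.swap q))"
    using hardy2_obtain_coef(1)[OF assms] summable_on_reindex_bij_betw[OF bij, of "\<lambda>q. (cmod (coef f q))\<^sup>2"]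
    by (simp add: sq_summable_def)
  have hs: "((\<lambda>q. coef f (prod.swap q) * bimonom q p) has_sum f (prod.swap p)) UNIV" if "p \<in> bidisc" for p
    using hardy2_has_sum[OF assms, of "prod.swap p"] that
      has_sum_reindex_bij_betw[OF bij, of "\<lambda>q. coef f q * bimonom (prod.swap q) p"]
    by (simp add: swap_bidisc bimonom_swap)
  from hardy2_coefI[OF sq hs] assms show
    "(\<lambda>p. f (prod.swap p)) \<in> hardy2" "coef (\<lambda>p. f (prod.swap p)) = (\<lambda>q. coef f (prod.swap q))"
    by (simp_all add: hardy2_outside swap_bidisc)
qed

lemma hinner_swap:
  assumes "f \<in> hardy2" "g \<in> hardy2"
  shows "hinner (\<lambda>p. f (prod.swap p)) (\<lambda>p. g (prod.swap p)) = hinner f g"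
  unfolding hinner_alt hardy2_swap(2)[OF assms(1)] hardy2_swap(2)[OF assms(2)]
  by (rule infsum_reindex_bij_betw) simp

lemma mult_emon_swap:
  "(\<lambda>p. u (prod.swap p) * emon q p) = (\<lambda>p. (\<lambda>p. u p * emon (prod.swap q) p) (prod.swap p))"
  by (rule ext) (simp add: emon_def bimonom_swap swap_bidisc)

lemma isometric_multiplier_swap:
  assumes "isometric_multiplier u"
  shows "isometric_multiplier (\<lambda>p. u (prod.swap p))"
  unfolding isometric_multiplier_def mult_emon_swap
proof (intro conjI allI)
  fix q r :: "nat \<times> nat"
  note e = mult_emon_hardy2[OF assms]
  show "(\<lambda>p. (\<lambda>p. u p * emon (prod.swap q) p) (prod.swap p)) \<in> hardy2" by (rule hardy2_swap(1)[OF e])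
  have "prod.swap q = prod.swap r \<longleftrightarrow> q = r" by (cases q; cases r) auto
  then show "hinner (\<lambda>p. (\<lambda>p. u p * emon (prod.swap q) p) (prod.swap p))
      (\<lambda>p. (\<lambda>p. u p * emon (prod.swap r) p) (prod.swap p)) = (if q = r then 1 else 0)"
    unfolding hinner_swap[OF e e] mult_emon_orthonormal[OF assms] by (simp only:)
qed

lemma mult_adj_swap:
  assumes u: "isometric_multiplier u" and f: "f \<in> hardy2"
  shows "mult_adj (\<lambda>p. u (prod.swap p)) (\<lambda>p. f (prod.swap p)) = (\<lambda>p. mult_adj u f (prod.swap p))"
proof (rule mult_adj_unique[OF isometric_multiplier_swap[OF u] hardy2_swap(1)[OF f]])
  show "(\<lambda>p. mult_adj u f (prod.swap p)) \<in> hardy2" by (intro hardy2_swap mult_adj_hardy2 u f)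
  fix h assume h: "h \<in> hardy2"
  define k where "k = (\<lambda>p. h (prod.swap p))"
  have k: "k \<in> hardy2" using hardy2_swap(1)[OF h] by (simp add: k_def)
  have hk: "h = (\<lambda>p. k (prod.swap p))" by (simp add: k_def)
  show "hinner (\<lambda>p. u (prod.swap p) * h p) (\<lambda>p. f (prod.swap p)) = hinner h (\<lambda>p. mult_adj u f (prod.swap p))"
    unfolding hk
    using hinner_swap[OF mult_hardy2[OF u k] f] hinner_swap[OF k mult_adj_hardy2[OF u f]] hinner_mult_left[OF u k f]
    by simp
qed

section \<open>Multipliers from inner functions\<close>

text \<open>The products of \<open>\<theta>\<close> with two monomials have disjoint coefficient supports when the degrees in
  \<open>w\<close> differ; otherwise their inner product is an autocorrelation sum of \<open>\<theta>\<close>.\<close>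

lemma isometric_multiplier_fst_powser:
  fixes s :: "nat \<Rightarrow> complex"
  assumes hs: "\<And>z. cmod z < 1 \<Longrightarrow> ((\<lambda>n. s n * z ^ n) has_sum \<theta> z) UNIV"
    and sq: "sq_summable s"
    and autocorr: "\<And>k. (\<Sum>\<^sub>\<infinity>n. s (n + k) * cnj (s n)) = (if k = 0 then 1 else 0)"
  shows "isometric_multiplier (\<lambda>p. \<theta> (fst p))"
proof -
  define c where "c m n q = (if snd q = n \<and> m \<le> fst q then s (fst q - m) else 0)" for m n and q :: "nat \<times> nat"
  have inj: "inj (\<lambda>i. (i + m, n))" for m n :: nat by (auto intro: injI)
  have range: "q \<in> range (\<lambda>i. (i + m, n)) \<longleftrightarrow> snd q = n \<and> m \<le> fst q" for q :: "nat \<times> nat" and m n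
  proof
    assume "snd q = n \<and> m \<le> fst q"
    then have "q = (\<lambda>i. (i + m, n)) (fst q - m)" by (cases q) simp
    then show "q \<in> range (\<lambda>i. (i + m, n))" by blast
  qed auto
  have csq: "sq_summable (c m n)" for m n
  proof -
    have "(\<lambda>q. (cmod (c m n q))\<^sup>2) \<circ> (\<lambda>i. (i + m, n)) = (\<lambda>i. (cmod (s i))\<^sup>2)"
      by (simp add: o_def c_def)
    then have "(\<lambda>q. (cmod (c m n q))\<^sup>2) summable_on range (\<lambda>i. (i + m, n))"
      using summable_on_reindex[OF inj[of m n], of "\<lambda>q. (cmod (c m n q))\<^sup>2"] sq
      by (simp only: sq_summable_def)
    then show ?thesis
      unfolding sq_summable_def
      by (rule summable_on_cong_neutral[THEN iffD1, rotated -1]) (auto simp: c_def range)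
  qed
  have chs: "((\<lambda>q. c m n q * bimonom q p) has_sum (\<theta> (fst p) * emon (m, n) p)) UNIV" if p: "p \<in> bidisc" for m n p
  proof -
    have "cmod (fst p) < 1" using p by (cases p) (simp add: bidisc_iff)
    from has_sum_cmult_left[OF hs[OF this], of "bimonom (m, n) p"]
    have "((\<lambda>i. c m n (i + m, n) * bimonom (i + m, n) p) has_sum (\<theta> (fst p) * emon (m, n) p)) UNIV"
      using p by (simp add: c_def bimonom_def emon_def power_add mult_ac)
    then have "((\<lambda>q. c m n q * bimonom q p) has_sum (\<theta> (fst p) * emon (m, n) p)) (range (\<lambda>i. (i + m, n)))"
      using has_sum_reindex[OF inj, of "\<lambda>q. c m n q * bimonom q p"] by (simp add: o_def)
    then show ?thesis
      by (rule has_sum_cong_neutral[THEN iffD1, rotated -1]) (auto simp: c_def range)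
  qed
  have zero: "\<theta> (fst p) * emon q p = 0" if "p \<notin> bidisc" for p q using that by (simp add: emon_def)
  have H: "(\<lambda>p. \<theta> (fst p) * emon (m, n) p) \<in> hardy2" "coef (\<lambda>p. \<theta> (fst p) * emon (m, n) p) = c m n" for m n
    using hardy2_coefI[OF csq chs] zero by simp_all
  \<comment> \<open>By conjugate symmetry it suffices to compare degrees with \<open>m \<le> m'\<close>.\<close>
  have le: "(\<Sum>\<^sub>\<infinity>q. c m n q * cnj (c m' n' q)) = (if (m, n) = (m', n') then 1 else 0)"
    if mm: "m \<le> m'" for m m' n n'
  proof (cases "n = n'")
    case False
    then have "c m n q * cnj (c m' n' q) = 0" for q by (simp add: c_def)
    then show ?thesis using False by (simp only: infsum_0_simp) simp
  next
    case True
    have "(\<Sum>\<^sub>\<infinity>q. c m n q * cnj (c m' n' q)) = (\<Sum>\<^sub>\<infinity>q\<in>range (\<lambda>i. (i + m', n')). c m n q * cnj (c m' n' q))"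
      by (rule infsum_cong_neutral) (auto simp: c_def range)
    also have "\<dots> = (\<Sum>\<^sub>\<infinity>i. c m n (i + m', n') * cnj (c m' n' (i + m', n')))"
      by (subst infsum_reindex[OF inj]) (simp add: o_def)
    also have "\<dots> = (\<Sum>\<^sub>\<infinity>i. s (i + (m' - m)) * cnj (s i))"
      using True mm by (simp add: c_def)
    finally show ?thesis using autocorr[of "m' - m"] True mm by auto
  qed
  have "hinner (\<lambda>p. \<theta> (fst p) * emon (m, n) p) (\<lambda>p. \<theta> (fst p) * emon (m', n') p) = (if (m, n) = (m', n') then 1 else 0)"
    for m n m' n'
  proof (cases "m \<le> m'")
    case True
    then show ?thesis using le by (simp add: hinner_alt H)
  next
    case False
    then have "hinner (\<lambda>p. \<theta> (fst p) * emon (m', n') p) (\<lambda>p. \<theta> (fst p) * emon (m, n) p) = 0"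
      using le[of m' m n' n] by (simp add: hinner_alt H)
    then show ?thesis using False hinner_cnj by (metis complex_cnj_zero order_refl prod.inject)
  qed
  with H(1) show ?thesis
    unfolding isometric_multiplier_def split_paired_All by blast
qed

lemma isometric_multiplier_inner:
  assumes "inner_function \<theta>"
  shows "isometric_multiplier (\<lambda>p. \<theta> (fst p))" and "isometric_multiplier (\<lambda>p. \<theta> (snd p))"
proof -
  show "isometric_multiplier (\<lambda>p. \<theta> (fst p))"
    by (rule inner_function_coefficients[OF assms]) (rule isometric_multiplier_fst_powser)
  from isometric_multiplier_swap[OF this] show "isometric_multiplier (\<lambda>p. \<theta> (snd p))" by simp
qed

lemma isometric_multiplier_fst: "isometric_multiplier fst"
  and isometric_multiplier_snd: "isometric_multiplier snd"
proof -
  have eq: "(\<lambda>p. fst p * emon (m, n) p) = emon (Suc m, n)" for m n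
    by (auto simp: fun_eq_iff emon_def bimonom_def)
  have "hinner (\<lambda>p. fst p * emon q p) (\<lambda>p. fst p * emon r p) = (if q = r then 1 else 0)"
    and "(\<lambda>p. fst p * emon q p) \<in> hardy2" for q r
    using eq[of "fst q" "snd q"] eq[of "fst r" "snd r"]
    by (auto simp: hinner_emon coef_emon emon_hardy2 prod_eq_iff)
  then show fst: "isometric_multiplier fst" unfolding isometric_multiplier_def by blast
  from isometric_multiplier_swap[OF fst] show "isometric_multiplier snd" by simp
qed

section \<open>Backward shifts\<close>

text \<open>The adjoint of multiplication by \<open>w\<close> shifts coefficients, so its kernel consists of the
  functions whose coefficients of positive degree in \<open>w\<close> vanish.\<close>

lemma mult_adj_snd_eq_0_iff:
  assumes f: "f \<in> hardy2"
  shows "mult_adj snd f = (\<lambda>p. 0) \<longleftrightarrow> (\<forall>(z, w)\<in>bidisc. f (z, w) = f (z, 0))"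
proof
  assume 0: "mult_adj snd f = (\<lambda>p. 0)"
  have eq: "(\<lambda>p. snd p * emon (m, n) p) = emon (m, Suc n)" for m n
    by (auto simp: fun_eq_iff emon_def bimonom_def)
  have c: "coef f (m, Suc n) = 0" for m n
    using coef_mult_adj[OF isometric_multiplier_snd f, of "(m, n)"] hinner_zero_left[of "emon (m, n)"]
    by (simp add: 0 eq hinner_emon)
  have eq: "coef f q * bimonom q (z, w) = coef f q * bimonom q (z, 0)" for q z w
    using c by (cases q; cases "snd q") (auto simp: bimonom_def)
  have "f (z, w) = f (z, 0)" if zw: "(z, w) \<in> bidisc" for z w
  proof -
    have "(z, 0) \<in> bidisc" using zw by (simp add: bidisc_iff)
    from has_sum_unique[OF hardy2_has_sum[OF f zw, unfolded eq[of _ z w]] hardy2_has_sum[OF f this]]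
    show ?thesis .
  qed
  then show "\<forall>(z, w)\<in>bidisc. f (z, w) = f (z, 0)" by blast
next
  assume indep: "\<forall>(z, w)\<in>bidisc. f (z, w) = f (z, 0)"
  have "coef f = (\<lambda>q. if snd q = 0 then coef f q else 0)"
  proof (rule coef_eqI)
    fix p assume p: "p \<in> bidisc"
    then have p0: "(fst p, 0) \<in> bidisc" by (cases p) (simp add: bidisc_iff)
    have eq0: "coef f q * bimonom q (fst p, 0) = (if snd q = 0 then coef f q else 0) * bimonom q p" for q
      by (simp add: bimonom_def)
    show "((\<lambda>q. (if snd q = 0 then coef f q else 0) * bimonom q p) has_sum f p) UNIV"
    proof -
      have "f (fst p, 0) = f p" using indep p by (cases p) auto
      then show ?thesis using hardy2_has_sum[OF f p0] eq0 by (simp only:)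
    qed
  qed
  then have c: "coef f (m, Suc n) = 0" for m n by (metis nat.distinct(1) snd_conv)
  show "mult_adj snd f = (\<lambda>p. 0)"
  proof (rule hardy2_eq_coefI)
    have eq: "(\<lambda>p. snd p * emon (m, n) p) = emon (m, Suc n)" for m n
      by (auto simp: fun_eq_iff emon_def bimonom_def)
    have "coef (mult_adj snd f) (m, n) = coef (\<lambda>p. 0) (m, n)" for m n
      using hinner_zero_left[of "emon (m, n)"]
      by (simp add: coef_mult_adj isometric_multiplier_snd f eq hinner_emon c)
    then show "coef (mult_adj snd f) = coef (\<lambda>p. 0)" by (auto simp: fun_eq_iff)
  qed (simp_all add: f hardy2_zero mult_adj_hardy2 isometric_multiplier_snd)
qed

lemma mult_adj_fst_eq_0_iff:
  assumes f: "f \<in> hardy2"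
  shows "mult_adj fst f = (\<lambda>p. 0) \<longleftrightarrow> (\<forall>(z, w)\<in>bidisc. f (z, w) = f (0, w))"
proof -
  have "mult_adj fst f = (\<lambda>p. 0) \<longleftrightarrow> mult_adj snd (\<lambda>p. f (prod.swap p)) = (\<lambda>p. 0)"
    using mult_adj_swap[OF isometric_multiplier_fst f] by (auto simp: fun_eq_iff)
  also have "\<dots> \<longleftrightarrow> (\<forall>(z, w)\<in>bidisc. f (z, w) = f (0, w))"
    unfolding mult_adj_snd_eq_0_iff[OF hardy2_swap(1)[OF f]] by (auto simp: bidisc_iff)
  finally show ?thesis .
qed

text \<open>The pointwise form of the backward shift. It allows dividing by \<open>w\<close> without treating \<open>w = 0\<close>
  separately.\<close>

lemma mult_adj_snd_eq:
  assumes f: "f \<in> hardy2" and p: "(z, w) \<in> bidisc"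
  shows "w * mult_adj snd f (z, w) = f (z, w) - f (z, 0)"
proof -
  note S = isometric_multiplier_snd
  let ?g = "\<lambda>p. f p - snd p * mult_adj snd f p"
  have g: "?g \<in> hardy2" by (intro hardy2_diff f mult_hardy2 mult_adj_hardy2 S)
  have "mult_adj snd ?g = (\<lambda>p. 0)"
    by (simp add: mult_adj_diff mult_hardy2 mult_adj_hardy2 S f mult_adj_mult)
  then have "?g (z, w) = ?g (z, 0)" using mult_adj_snd_eq_0_iff[OF g] p by blast
  then show ?thesis by (simp add: algebra_simps)
qed

lemma mult_adj_fst_eq:
  assumes f: "f \<in> hardy2" and p: "(z, w) \<in> bidisc"
  shows "z * mult_adj fst f (z, w) = f (z, w) - f (0, w)"
proof -
  note S = isometric_multiplier_fst
  let ?g = "\<lambda>p. f p - fst p * mult_adj fst f p"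
  have g: "?g \<in> hardy2" by (intro hardy2_diff f mult_hardy2 mult_adj_hardy2 S)
  have "mult_adj fst ?g = (\<lambda>p. 0)"
    by (simp add: mult_adj_diff mult_hardy2 mult_adj_hardy2 S f mult_adj_mult)
  then have "?g (z, w) = ?g (0, w)" using mult_adj_fst_eq_0_iff[OF g] p by blast
  then show ?thesis by (simp add: algebra_simps)
qed

section \<open>Commutation of shifts and multipliers\<close>

lemma mult_adj_zero: "isometric_multiplier u \<Longrightarrow> mult_adj u (\<lambda>p. 0) = (\<lambda>p. 0)"
  using mult_adj_cmult[OF _ hardy2_zero, of u 0] by simp

lemma mult_adj_snd_eqI:
  assumes g: "g \<in> hardy2" and k: "k \<in> hardy2"
    and eq: "\<And>z w. (z, w) \<in> bidisc \<Longrightarrow> w * k (z, w) = g (z, w) - g (z, 0)"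
  shows "mult_adj snd g = k"
proof -
  note S = isometric_multiplier_snd
  have wk: "(\<lambda>p. snd p * k p) \<in> hardy2" by (rule mult_hardy2[OF S k])
  have "\<forall>(z, w)\<in>bidisc. g (z, w) - snd (z, w) * k (z, w) = g (z, 0) - snd (z, 0::complex) * k (z, 0)"
    using eq by auto
  then have "mult_adj snd (\<lambda>p. g p - snd p * k p) = (\<lambda>p. 0)"
    using mult_adj_snd_eq_0_iff[OF hardy2_diff[OF g wk]] by blast
  then show ?thesis
    by (simp add: mult_adj_diff S g wk mult_adj_mult k fun_eq_iff)
qed

lemma mult_adj_fst_eqI:
  assumes g: "g \<in> hardy2" and k: "k \<in> hardy2"
    and eq: "\<And>z w. (z, w) \<in> bidisc \<Longrightarrow> z * k (z, w) = g (z, w) - g (0, w)"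
  shows "mult_adj fst g = k"
proof -
  note S = isometric_multiplier_fst
  have wk: "(\<lambda>p. fst p * k p) \<in> hardy2" by (rule mult_hardy2[OF S k])
  have "\<forall>(z, w)\<in>bidisc. g (z, w) - fst (z, w) * k (z, w) = g (0, w) - fst (0::complex, w) * k (0, w)"
    using eq by auto
  then have "mult_adj fst (\<lambda>p. g p - fst p * k p) = (\<lambda>p. 0)"
    using mult_adj_fst_eq_0_iff[OF hardy2_diff[OF g wk]] by blast
  then show ?thesis
    by (simp add: mult_adj_diff S g wk mult_adj_mult k fun_eq_iff)
qed

text \<open>The adjoint form of the commutation of \<open>u\<close> with the adjoint of \<open>v\<close>.\<close>

lemma mult_adj_mult_commute:
  assumes u: "isometric_multiplier u" and v: "isometric_multiplier v" and h: "h \<in> hardy2"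
    and comm: "\<And>g. g \<in> hardy2 \<Longrightarrow> mult_adj v (\<lambda>p. u p * g p) = (\<lambda>p. u p * mult_adj v g p)"
  shows "mult_adj u (\<lambda>p. v p * h p) = (\<lambda>p. v p * mult_adj u h p)"
proof (rule mult_adj_unique[OF u mult_hardy2[OF v h] mult_hardy2[OF v mult_adj_hardy2[OF u h]]])
  fix g assume g: "g \<in> hardy2"
  have "hinner (\<lambda>p. u p * g p) (\<lambda>p. v p * h p) = hinner (\<lambda>p. u p * mult_adj v g p) h"
    using hinner_mult_right[OF v h mult_hardy2[OF u g]] comm[OF g] by simp
  also have "\<dots> = hinner (mult_adj v g) (mult_adj u h)"
    by (rule hinner_mult_left[OF u mult_adj_hardy2[OF v g] h])
  also have "\<dots> = hinner g (\<lambda>p. v p * mult_adj u h p)"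
    by (rule hinner_mult_right[OF v mult_adj_hardy2[OF u h] g, symmetric])
  finally show "hinner (\<lambda>p. u p * g p) (\<lambda>p. v p * h p) = hinner g (\<lambda>p. v p * mult_adj u h p)" .
qed

lemma mult_adj_fst_fun_mult_snd:
  assumes u: "isometric_multiplier (\<lambda>p. \<theta> (fst p))" and h: "h \<in> hardy2"
  shows "mult_adj (\<lambda>p. \<theta> (fst p)) (\<lambda>p. snd p * h p) = (\<lambda>p. snd p * mult_adj (\<lambda>p. \<theta> (fst p)) h p)"
proof (rule mult_adj_mult_commute[OF u isometric_multiplier_snd h], rule mult_adj_snd_eqI)
  fix g :: "complex \<times> complex \<Rightarrow> complex" and z w :: complex assume "g \<in> hardy2" "(z, w) \<in> bidisc"
  from arg_cong[OF mult_adj_snd_eq[OF this], of "\<lambda>x. \<theta> z * x"]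
  show "w * (\<theta> (fst (z, w)) * mult_adj snd g (z, w)) = \<theta> (fst (z, w)) * g (z, w) - \<theta> (fst (z, 0::complex)) * g (z, 0)"
    by (simp add: algebra_simps)
qed (intro mult_hardy2[OF u] mult_adj_hardy2 isometric_multiplier_snd; assumption)+

lemma mult_adj_snd_fun_mult_fst:
  assumes u: "isometric_multiplier (\<lambda>p. \<theta> (snd p))" and h: "h \<in> hardy2"
  shows "mult_adj (\<lambda>p. \<theta> (snd p)) (\<lambda>p. fst p * h p) = (\<lambda>p. fst p * mult_adj (\<lambda>p. \<theta> (snd p)) h p)"
proof (rule mult_adj_mult_commute[OF u isometric_multiplier_fst h], rule mult_adj_fst_eqI)
  fix g :: "complex \<times> complex \<Rightarrow> complex" and z w :: complex assume "g \<in> hardy2" "(z, w) \<in> bidisc"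
  from arg_cong[OF mult_adj_fst_eq[OF this], of "\<lambda>x. \<theta> w * x"]
  show "z * (\<theta> (snd (z, w)) * mult_adj fst g (z, w)) = \<theta> (snd (z, w)) * g (z, w) - \<theta> (snd (0::complex, w)) * g (0, w)"
    by (simp add: algebra_simps)
qed (intro mult_hardy2[OF u] mult_adj_hardy2 isometric_multiplier_fst; assumption)+

section \<open>The quotient module of a principal submodule\<close>

definition principal :: "(complex \<times> complex \<Rightarrow> complex) \<Rightarrow> (complex \<times> complex \<Rightarrow> complex) set" where
  "principal u = (\<lambda>f p. u p * f p) ` hardy2"

text \<open>A nonzero constant factor of the multiplier does not change the submodule. This removes the
  constants from all cases of the theorem.\<close>

lemma product_submodule_eq_principal:
  assumes "c \<noteq> 0" "\<And>z w. (z, w) \<in> bidisc \<Longrightarrow> \<theta>\<^sub>1 z * \<theta>\<^sub>2 w = c * u (z, w)"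
  shows "product_submodule \<theta>\<^sub>1 \<theta>\<^sub>2 = principal u"
proof -
  have eq: "(\<lambda>(z, w). \<theta>\<^sub>1 z * \<theta>\<^sub>2 w * f (z, w)) = (\<lambda>p. u p * (c * f p))" if f: "f \<in> hardy2" for f
  proof
    fix p
    show "(\<lambda>(z, w). \<theta>\<^sub>1 z * \<theta>\<^sub>2 w * f (z, w)) p = u p * (c * f p)"
      using assms(2)[of "fst p" "snd p"] hardy2_outside[OF f, of p]
      by (cases "p \<in> bidisc"; cases p) auto
  qed
  have "g \<in> (\<lambda>f p. c * f p) ` hardy2" if "g \<in> hardy2" for g
    using hardy2_cmult(1)[OF that, of "1 / c"] assms(1) by (intro image_eqI[of _ _ "\<lambda>p. 1 / c * g p"]) auto
  then have "hardy2 = (\<lambda>f p. c * f p) ` hardy2" using hardy2_cmult(1) by blast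
  then have "principal u = (\<lambda>f p. u p * f p) ` (\<lambda>f p. c * f p) ` hardy2"
    unfolding principal_def by (rule arg_cong)
  also have "\<dots> = product_submodule \<theta>\<^sub>1 \<theta>\<^sub>2"
    unfolding product_submodule_def image_image by (rule image_cong) (simp_all add: eq)
  finally show ?thesis by simp
qed

lemma M1_eq: "M1 f = (\<lambda>p. fst p * f p)" and M2_eq: "M2 f = (\<lambda>p. snd p * f p)"
  by (auto simp: M1_def M2_def fun_eq_iff)

text \<open>The orthogonal projection onto the complement of \<open>principal u\<close> when \<open>u\<close> multiplies
  isometrically (\<open>orth_proj_principal\<close>).\<close>

definition co_proj ::
    "(complex \<times> complex \<Rightarrow> complex) \<Rightarrow> (complex \<times> complex \<Rightarrow> complex) \<Rightarrow> complex \<times> complex \<Rightarrow> complex" where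
  "co_proj u f = (\<lambda>p. f p - u p * mult_adj u f p)"

lemma adjoint_on_hardy2:
  assumes v: "isometric_multiplier v" and g: "g \<in> hardy2"
  shows "adjoint_on hardy2 (\<lambda>f p. v p * f p) g = mult_adj v g"
  unfolding adjoint_on_def
proof (rule the_equality)
  show "mult_adj v g \<in> hardy2 \<and> (\<forall>f\<in>hardy2. hinner (\<lambda>p. v p * f p) g = hinner f (mult_adj v g))"
    using hinner_mult_left[OF v _ g] mult_adj_hardy2[OF v g] by blast
  show "h = mult_adj v g" if "h \<in> hardy2 \<and> (\<forall>f\<in>hardy2. hinner (\<lambda>p. v p * f p) g = hinner f h)" for h
    using mult_adj_unique[OF v g, of h] that by auto
qed

context
  fixes u :: "complex \<times> complex \<Rightarrow> complex"
  assumes u: "isometric_multiplier u"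
begin

lemma orth_compl_principal_iff:
  "f \<in> orth_compl (principal u) \<longleftrightarrow> f \<in> hardy2 \<and> mult_adj u f = (\<lambda>p. 0)"
proof
  assume *: "f \<in> orth_compl (principal u)"
  then have f: "f \<in> hardy2" by (simp add: orth_compl_def)
  note A = mult_adj_hardy2[OF u f]
  have "hinner (mult_adj u f) (mult_adj u f) = hinner f (\<lambda>p. u p * mult_adj u f p)"
    by (rule hinner_mult_right[OF u A f, symmetric])
  also have "\<dots> = 0" using * A by (auto simp: orth_compl_def principal_def)
  finally show "f \<in> hardy2 \<and> mult_adj u f = (\<lambda>p. 0)" using f hinner_self_eq_0[OF A] by simp
next
  assume "f \<in> hardy2 \<and> mult_adj u f = (\<lambda>p. 0)"
  then show "f \<in> orth_compl (principal u)"
    by (auto simp: orth_compl_def principal_def hinner_mult_right[OF u] hinner_zero_left)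
qed

lemma co_proj_hardy2: "f \<in> hardy2 \<Longrightarrow> co_proj u f \<in> hardy2"
  unfolding co_proj_def by (intro hardy2_diff mult_hardy2 mult_adj_hardy2 u)

lemma mult_adj_co_proj: "f \<in> hardy2 \<Longrightarrow> mult_adj u (co_proj u f) = (\<lambda>p. 0)"
  unfolding co_proj_def by (simp add: mult_adj_diff mult_hardy2 mult_adj_hardy2 u mult_adj_mult)

lemma co_proj_in: "f \<in> hardy2 \<Longrightarrow> co_proj u f \<in> orth_compl (principal u)"
  by (simp add: orth_compl_principal_iff co_proj_hardy2 mult_adj_co_proj)

lemma hinner_co_proj_left:
  assumes "f \<in> hardy2" "h \<in> hardy2"
  shows "hinner (co_proj u f) h = hinner f h - hinner (mult_adj u f) (mult_adj u h)"
  using assms unfolding co_proj_def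
  by (simp add: hinner_diff_left mult_hardy2 mult_adj_hardy2 u hinner_mult_left)

lemma co_proj_cmult:
  "f \<in> hardy2 \<Longrightarrow> co_proj u (\<lambda>p. c * f p) = (\<lambda>p. c * co_proj u f p)"
  by (simp add: co_proj_def mult_adj_cmult u algebra_simps)

lemma co_proj_diff:
  "f \<in> hardy2 \<Longrightarrow> g \<in> hardy2 \<Longrightarrow> co_proj u (\<lambda>p. f p - g p) = (\<lambda>p. co_proj u f p - co_proj u g p)"
  by (simp add: co_proj_def mult_adj_diff u algebra_simps)

lemma co_proj_mult: "f \<in> hardy2 \<Longrightarrow> co_proj u (\<lambda>p. u p * f p) = (\<lambda>p. 0)"
  by (simp add: co_proj_def mult_adj_mult u)

lemma orth_proj_principal:
  assumes f: "f \<in> hardy2"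
  shows "orth_proj (orth_compl (principal u)) f = co_proj u f"
  unfolding orth_proj_def
proof (rule the_equality)
  let ?Q = "orth_compl (principal u)"
  have "hinner (\<lambda>p. f p - co_proj u f p) g = 0" if "g \<in> ?Q" for g
    using that f by (simp add: co_proj_def orth_compl_principal_iff hinner_mult_left[OF u] mult_adj_hardy2 u hinner_zero_right)
  then show P: "co_proj u f \<in> ?Q \<and> (\<lambda>p. f p - co_proj u f p) \<in> orth_compl ?Q"
    using f by (auto simp: co_proj_in orth_compl_def[of ?Q] hardy2_diff co_proj_hardy2)
  fix g assume g: "g \<in> ?Q \<and> (\<lambda>p. f p - g p) \<in> orth_compl ?Q"
  then have gh: "g \<in> hardy2" by (simp add: orth_compl_principal_iff)
  let ?d = "\<lambda>p. g p - co_proj u f p"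
  have d: "?d \<in> hardy2" by (intro hardy2_diff gh co_proj_hardy2 f)
  have dQ: "?d \<in> ?Q"
    using g d by (simp add: orth_compl_principal_iff mult_adj_diff u gh co_proj_hardy2 f mult_adj_co_proj)
  have "hinner (\<lambda>p. (f p - co_proj u f p) - (f p - g p)) ?d = 0"
    using g P dQ d by (subst hinner_diff_left) (auto simp: orth_compl_def[of ?Q])
  then have "hinner ?d ?d = 0" by simp
  from hinner_self_eq_0[OF d this] show "g = co_proj u f" by (simp add: fun_eq_iff)
qed

lemma mult_adj_in_orth_compl:
  assumes v: "isometric_multiplier v" and f: "f \<in> orth_compl (principal u)"
  shows "mult_adj v f \<in> orth_compl (principal u)"
  using f mult_adj_commute[OF u v, of f]
  by (simp add: orth_compl_principal_iff mult_adj_hardy2 v mult_adj_zero)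

lemma quotient_module_principal: "quotient_module (orth_compl (principal u))"
  unfolding quotient_module_def closed_subspace_def
proof (intro conjI ballI allI impI)
  let ?Q = "orth_compl (principal u)"
  show "?Q \<subseteq> hardy2" by (auto simp: orth_compl_def)
  show "(\<lambda>p. 0) \<in> ?Q" by (simp add: orth_compl_principal_iff hardy2_zero mult_adj_zero u)
  show "(\<lambda>p. f p + g p) \<in> ?Q" if "f \<in> ?Q" "g \<in> ?Q" for f g
    using that by (simp add: orth_compl_principal_iff hardy2_add mult_adj_add u)
  show "(\<lambda>p. c * f p) \<in> ?Q" if "f \<in> ?Q" for f c
    using that by (simp add: orth_compl_principal_iff hardy2_cmult mult_adj_cmult u)
  show "adjoint_on hardy2 M1 f \<in> ?Q" if "f \<in> ?Q" for f
  proof -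
    have "adjoint_on hardy2 M1 f = mult_adj fst f"
      using adjoint_on_hardy2[OF isometric_multiplier_fst, of f] that
      by (simp add: M1_eq[abs_def] orth_compl_principal_iff)
    then show ?thesis using mult_adj_in_orth_compl[OF isometric_multiplier_fst that] by simp
  qed
  show "adjoint_on hardy2 M2 f \<in> ?Q" if "f \<in> ?Q" for f
  proof -
    have "adjoint_on hardy2 M2 f = mult_adj snd f"
      using adjoint_on_hardy2[OF isometric_multiplier_snd, of f] that
      by (simp add: M2_eq[abs_def] orth_compl_principal_iff)
    then show ?thesis using mult_adj_in_orth_compl[OF isometric_multiplier_snd that] by simp
  qed
  fix F :: "nat \<Rightarrow> complex \<times> complex \<Rightarrow> complex" and f
  assume f: "f \<in> hardy2" and F: "\<forall>k. F k \<in> ?Q" and lim: "(\<lambda>k. hnorm (\<lambda>p. F k p - f p)) \<longlonglongrightarrow> 0"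
  have Fh: "F k \<in> hardy2" for k using F by (simp add: orth_compl_principal_iff)
  have "hinner f g = 0" if g: "g \<in> principal u" for g
  proof -
    have gh: "g \<in> hardy2" using g mult_hardy2[OF u] by (auto simp: principal_def)
    have "cmod (hinner f g) \<le> hnorm (\<lambda>p. F k p - f p) * sqrt (norm2 g)" for k
    proof -
      have Ff: "(\<lambda>p. F k p - f p) \<in> hardy2" by (intro hardy2_diff Fh f)
      have "hinner (F k) g = 0" using F g by (auto simp: orth_compl_def)
      then have "hinner (\<lambda>p. F k p - f p) g = - hinner f g"
        by (simp add: hinner_diff_left Fh f gh)
      then have "(cmod (hinner f g))\<^sup>2 \<le> norm2 (\<lambda>p. F k p - f p) * norm2 g"
        using hinner_Cauchy_Schwarz[OF Ff gh] by simp
      then have "cmod (hinner f g) \<le> sqrt (norm2 (\<lambda>p. F k p - f p) * norm2 g)"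
        by (rule real_le_rsqrt)
      then show ?thesis
        using Ff by (simp add: hnorm_def hinner_self real_sqrt_mult)
    qed
    moreover have "(\<lambda>k. hnorm (\<lambda>p. F k p - f p) * sqrt (norm2 g)) \<longlonglongrightarrow> 0 * sqrt (norm2 g)"
      by (intro tendsto_intros lim)
    ultimately have "cmod (hinner f g) \<le> 0"
      by (intro LIMSEQ_le_const[of _ "0::real"]) auto
    then show ?thesis by simp
  qed
  with f show "f \<in> ?Q" by (simp add: orth_compl_def)
qed

lemma compression_M2_adjoint:
  assumes g: "g \<in> orth_compl (principal u)"
  shows "adjoint_on (orth_compl (principal u)) (compression (orth_compl (principal u)) M2) g = mult_adj snd g"
  unfolding adjoint_on_def
proof (rule the_equality)
  let ?Q = "orth_compl (principal u)"
  note S = isometric_multiplier_snd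
  have gh: "g \<in> hardy2" and g0: "mult_adj u g = (\<lambda>p. 0)" using g by (simp_all add: orth_compl_principal_iff)
  have eq: "hinner (compression ?Q M2 f) g = hinner f (mult_adj snd g)" if "f \<in> ?Q" for f
  proof -
    have f: "f \<in> hardy2" using that by (simp add: orth_compl_principal_iff)
    have "compression ?Q M2 f = co_proj u (\<lambda>p. snd p * f p)"
      unfolding compression_def M2_eq by (rule orth_proj_principal[OF mult_hardy2[OF S f]])
    then show ?thesis
      by (simp add: hinner_co_proj_left mult_hardy2 S f gh g0 hinner_zero_right hinner_mult_left)
  qed
  then show *: "mult_adj snd g \<in> ?Q \<and> (\<forall>f\<in>?Q. hinner (compression ?Q M2 f) g = hinner f (mult_adj snd g))"
    using mult_adj_in_orth_compl[OF S g] by blast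
  fix h assume h: "h \<in> ?Q \<and> (\<forall>f\<in>?Q. hinner (compression ?Q M2 f) g = hinner f h)"
  let ?d = "\<lambda>p. h p - mult_adj snd g p"
  have hh: "h \<in> hardy2" "mult_adj u h = (\<lambda>p. 0)" and kh: "mult_adj snd g \<in> hardy2" "mult_adj u (mult_adj snd g) = (\<lambda>p. 0)"
    using h * by (simp_all add: orth_compl_principal_iff)
  have d: "?d \<in> hardy2" "?d \<in> ?Q"
    using hh kh by (simp_all add: orth_compl_principal_iff hardy2_diff mult_adj_diff u)
  have "hinner ?d ?d = hinner ?d h - hinner ?d (mult_adj snd g)"
    by (rule hinner_diff_right[OF hh(1) kh(1) d(1)])
  also have "\<dots> = 0" using h * d(2) by (metis cancel_comm_monoid_add_class.diff_cancel)
  finally have "?d = (\<lambda>p. 0)" by (rule hinner_self_eq_0[OF d(1)])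
  then show "h = mult_adj snd g" by (simp add: fun_eq_iff)
qed

text \<open>The inner projection in \<open>Q\<^sub>1 Q\<^sub>2\<close> disappears: it changes its argument by a multiple of \<open>u\<close>,
  which remains a multiple of \<open>u\<close> after multiplication by \<open>z\<close> and is killed by the outer
  projection.\<close>

lemma phi_doubly_commuting_principal_iff:
  "phi_doubly_commuting (orth_compl (principal u)) \<longleftrightarrow>
    (\<forall>f\<in>orth_compl (principal u).
       co_proj u (\<lambda>p. fst p * (snd p * mult_adj snd f p)) = mult_adj snd (co_proj u (\<lambda>p. fst p * (snd p * f p))))"
proof -
  let ?Q = "orth_compl (principal u)"
  note F = isometric_multiplier_fst and S = isometric_multiplier_snd
  have comp1: "compression ?Q M1 g = co_proj u (\<lambda>p. fst p * g p)" if "g \<in> hardy2" for g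
    unfolding compression_def M1_eq by (rule orth_proj_principal[OF mult_hardy2[OF F that]])
  have comp2: "compression ?Q M2 g = co_proj u (\<lambda>p. snd p * g p)" if "g \<in> hardy2" for g
    unfolding compression_def M2_eq by (rule orth_proj_principal[OF mult_hardy2[OF S that]])
  have comp: "compression ?Q M1 (compression ?Q M2 g) = co_proj u (\<lambda>p. fst p * (snd p * g p))"
    if g: "g \<in> hardy2" for g
  proof -
    let ?k = "mult_adj u (\<lambda>p. snd p * g p)"
    have k: "?k \<in> hardy2" by (intro mult_adj_hardy2 u mult_hardy2 S g)
    have "compression ?Q M1 (compression ?Q M2 g) = co_proj u (\<lambda>p. fst p * co_proj u (\<lambda>p. snd p * g p) p)"
      by (simp add: comp1 comp2 g co_proj_hardy2 mult_hardy2 S)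
    also have "\<dots> = co_proj u (\<lambda>p. fst p * (snd p * g p) - u p * (fst p * ?k p))"
      by (simp add: co_proj_def[of u "\<lambda>p. snd p * g p"] algebra_simps)
    also have "\<dots> = co_proj u (\<lambda>p. fst p * (snd p * g p))"
      by (simp add: co_proj_diff co_proj_mult mult_hardy2 F S u g k)
    finally show ?thesis .
  qed
  have "compression ?Q M1 (compression ?Q M2 (adjoint_on ?Q (compression ?Q M2) f)) =
      co_proj u (\<lambda>p. fst p * (snd p * mult_adj snd f p))"
    and "adjoint_on ?Q (compression ?Q M2) (compression ?Q M1 (compression ?Q M2 f)) =
      mult_adj snd (co_proj u (\<lambda>p. fst p * (snd p * f p)))" if "f \<in> ?Q" for f
  proof -
    have f: "f \<in> hardy2" using that by (simp add: orth_compl_principal_iff)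
    show "compression ?Q M1 (compression ?Q M2 (adjoint_on ?Q (compression ?Q M2) f)) =
        co_proj u (\<lambda>p. fst p * (snd p * mult_adj snd f p))"
      unfolding compression_M2_adjoint[OF that] by (rule comp[OF mult_adj_hardy2[OF S f]])
    show "adjoint_on ?Q (compression ?Q M2) (compression ?Q M1 (compression ?Q M2 f)) =
      mult_adj snd (co_proj u (\<lambda>p. fst p * (snd p * f p)))"
      unfolding comp[OF f] by (intro compression_M2_adjoint co_proj_in mult_hardy2 F S f)
  qed
  then show ?thesis
    by (simp add: phi_doubly_commuting_def quotient_module_principal Let_def)
qed

text \<open>The commutation relation paired with \<open>h\<close>. As \<open>f - w B\<^sub>2 f\<close> is \<open>f(z,0)\<close>, this is the identity
  \<open>\<langle>z f(z,0), h\<rangle> = \<langle>A(z w f), A(w h)\<rangle>\<close>, with \<open>A\<close> the adjoint of multiplication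
  by \<open>u\<close>; all necessary conditions are extracted from it.\<close>

lemma phi_doubly_commuting_weak:
  assumes comm: "phi_doubly_commuting (orth_compl (principal u))"
    and f: "f \<in> hardy2" "mult_adj u f = (\<lambda>p. 0)" and h: "h \<in> hardy2" "mult_adj u h = (\<lambda>p. 0)"
  shows "hinner (\<lambda>p. fst p * (f p - snd p * mult_adj snd f p)) h =
     hinner (mult_adj u (\<lambda>p. fst p * (snd p * f p))) (mult_adj u (\<lambda>p. snd p * h p))"
proof -
  note F = isometric_multiplier_fst and S = isometric_multiplier_snd
  let ?g = "\<lambda>p. fst p * (snd p * f p)"
  have mem: "(\<lambda>p. fst p * (snd p * mult_adj snd f p)) \<in> hardy2" "?g \<in> hardy2" "(\<lambda>p. snd p * h p) \<in> hardy2"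
    "(\<lambda>p. fst p * f p) \<in> hardy2"
    by (intro mult_hardy2 mult_adj_hardy2 F S f h)+
  have "hinner (\<lambda>p. fst p * (snd p * mult_adj snd f p)) h = hinner (co_proj u (\<lambda>p. fst p * (snd p * mult_adj snd f p))) h"
    using mem h by (simp add: hinner_co_proj_left hinner_zero_right)
  also have "\<dots> = hinner (mult_adj snd (co_proj u ?g)) h"
    using comm f unfolding phi_doubly_commuting_principal_iff by (simp add: orth_compl_principal_iff)
  also have "\<dots> = hinner (co_proj u ?g) (\<lambda>p. snd p * h p)"
    using mem h by (simp add: hinner_mult_right S co_proj_hardy2)
  also have "\<dots> = hinner ?g (\<lambda>p. snd p * h p) - hinner (mult_adj u ?g) (mult_adj u (\<lambda>p. snd p * h p))"
    by (rule hinner_co_proj_left[OF mem(2,3)])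
  also have "hinner ?g (\<lambda>p. snd p * h p) = hinner (\<lambda>p. fst p * f p) h"
    using hinner_mult_mult[OF S mem(4) h(1)] by (simp add: mult.left_commute)
  finally show ?thesis
    using mem h by (simp add: right_diff_distrib hinner_diff_left)
qed

end

section \<open>Test vectors\<close>

abbreviation one :: "complex \<times> complex \<Rightarrow> complex" where
  "one \<equiv> emon (0, 0)"

lemma one_apply: "p \<in> bidisc \<Longrightarrow> one p = 1"
  by (simp add: emon_def bimonom_def)

lemma zero_in_bidisc: "(0, 0) \<in> bidisc"
  by (simp add: bidisc_iff)

lemma kern_zero: "kern (0, 0) = one"
  by (rule hardy2_eq_coefI)
    (auto simp: kern_hardy2 zero_in_bidisc emon_hardy2 coef_kern coef_emon bimonom_def fun_eq_iff)

lemma hinner_one: "f \<in> hardy2 \<Longrightarrow> hinner f one = f (0, 0)"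
  using hinner_kern[OF _ zero_in_bidisc] by (simp add: kern_zero)

lemma hinner_one_left: "f \<in> hardy2 \<Longrightarrow> hinner one f = cnj (f (0, 0))"
  using hinner_one hinner_cnj by metis

lemma hinner_one_one: "hinner one one = 1"
  by (simp add: hinner_one emon_hardy2 one_apply zero_in_bidisc)

lemma mult_adj_one: "isometric_multiplier v \<Longrightarrow> mult_adj v one = (\<lambda>p. cnj (v (0, 0)) * one p)"
  using mult_adj_kern[OF _ zero_in_bidisc] by (simp add: kern_zero)

lemma shifts_one: "mult_adj fst one = (\<lambda>p. 0)" "mult_adj snd one = (\<lambda>p. 0)"
  by (simp_all add: mult_adj_one isometric_multiplier_fst isometric_multiplier_snd)

lemma cmod_eq_1I:
  assumes "c * cnj c = 1"
  shows "cmod c = 1"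
proof -
  have "(cmod c)\<^sup>2 = 1" using assms by (metis complex_norm_square of_real_eq_1_iff)
  then show ?thesis by (simp add: power2_eq_1_iff) (use norm_ge_zero[of c] in linarith)
qed

text \<open>Equality in the Cauchy-Schwarz inequality: under these hypotheses \<open>f - c g\<close> has norm zero.\<close>

lemma hardy2_eq_cmultI:
  assumes f: "f \<in> hardy2" and g: "g \<in> hardy2"
    and inner: "hinner f g = c * hinner g g" and norm: "hinner f f = c * cnj c * hinner g g"
  shows "f = (\<lambda>p. c * g p)"
proof -
  have cg: "(\<lambda>p. c * g p) \<in> hardy2" by (rule hardy2_cmult(1)[OF g])
  have d: "(\<lambda>p. f p - c * g p) \<in> hardy2" by (rule hardy2_diff[OF f cg])
  have gf: "hinner g f = cnj c * hinner g g"
    using inner hinner_cnj[of g f] hinner_cnj[of g g] by simp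
  have "hinner (\<lambda>p. f p - c * g p) (\<lambda>p. f p - c * g p) = 0"
    using f g cg d gf inner norm
    by (simp add: hinner_diff_left hinner_diff_right hinner_cmult_left hinner_cmult_right algebra_simps)
  from hinner_self_eq_0[OF d this] show ?thesis by (simp add: fun_eq_iff)
qed

lemma constant_if_shifts_zero:
  assumes f: "f \<in> hardy2" and z: "mult_adj fst f = (\<lambda>p. 0)" and w: "mult_adj snd f = (\<lambda>p. 0)"
  shows "f = (\<lambda>p. f (0, 0) * one p)"
proof (rule hardy2_eqI[OF f hardy2_cmult(1)[OF emon_hardy2]])
  fix p assume p: "p \<in> bidisc"
  obtain a b where ab: "p = (a, b)" by (cases p)
  then have "f (a, b) = f (a, 0)" and "f (a, 0) = f (0, 0)"
    using mult_adj_snd_eq_0_iff[OF f] mult_adj_fst_eq_0_iff[OF f] z w p by (auto simp: bidisc_iff)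
  then show "f p = f (0, 0) * one p" using ab p by (simp add: one_apply)
qed

text \<open>The test vectors \<open>v \<cdot> 1\<close>, the projection \<open>1 - cnj (v(0)) v\<close> of \<open>1\<close> to the kernel of the
  adjoint of \<open>v\<close>, and \<open>v - v(0)\<close>.\<close>

definition mult_one :: "(complex \<times> complex \<Rightarrow> complex) \<Rightarrow> complex \<times> complex \<Rightarrow> complex" where
  "mult_one v p = v p * one p"

definition defect_one :: "(complex \<times> complex \<Rightarrow> complex) \<Rightarrow> complex \<times> complex \<Rightarrow> complex" where
  "defect_one v p = one p - cnj (v (0, 0)) * mult_one v p"

definition centred_one :: "(complex \<times> complex \<Rightarrow> complex) \<Rightarrow> complex \<times> complex \<Rightarrow> complex" where
  "centred_one v p = mult_one v p - v (0, 0) * one p"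

context
  fixes v :: "complex \<times> complex \<Rightarrow> complex"
  assumes v: "isometric_multiplier v"
begin

lemma mult_one_hardy2: "(mult_one v) \<in> hardy2"
  unfolding mult_one_def[abs_def] by (rule mult_hardy2[OF v emon_hardy2])

lemma mult_one_apply: "p \<in> bidisc \<Longrightarrow> mult_one v p = v p"
  by (simp add: mult_one_def one_apply)

lemma hinner_mult_one_self: "hinner (mult_one v) (mult_one v) = 1"
  unfolding mult_one_def[abs_def] by (simp add: hinner_mult_mult v emon_hardy2 hinner_one_one)

lemma mult_adj_mult_one: "mult_adj v (mult_one v) = one"
  unfolding mult_one_def[abs_def] by (rule mult_adj_mult[OF v emon_hardy2])

lemma hinner_mult_one_one: "hinner (mult_one v) one = v (0, 0)" "hinner one (mult_one v) = cnj (v (0, 0))"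
  by (simp_all add: hinner_one hinner_one_left mult_one_hardy2 mult_one_apply zero_in_bidisc)

text \<open>The vector \<open>mult_one v\<close> has norm one, so a value of modulus one at the origin leaves no
  room for any other coefficient.\<close>

lemma constant_if_unimodular_at_0:
  assumes "v (0, 0) * cnj (v (0, 0)) = 1" "p \<in> bidisc"
  shows "v p = v (0, 0)"
proof -
  have "(mult_one v) = (\<lambda>p. v (0, 0) * one p)"
    by (rule hardy2_eq_cmultI[OF mult_one_hardy2 emon_hardy2])
      (simp_all add: hinner_mult_one_one hinner_mult_one_self hinner_one_one assms(1))
  then show ?thesis using assms(2) by (metis mult_one_apply one_apply mult.right_neutral)
qed

lemma defect_one_hardy2: "(defect_one v) \<in> hardy2"
  unfolding defect_one_def[abs_def] by (intro hardy2_diff hardy2_cmult emon_hardy2 mult_one_hardy2)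

lemma mult_adj_defect_one: "mult_adj v (defect_one v) = (\<lambda>p. 0)"
  unfolding defect_one_def[abs_def]
  by (simp add: mult_adj_diff mult_adj_cmult v hardy2_cmult emon_hardy2 mult_one_hardy2 mult_adj_mult_one mult_adj_one)

lemma hinner_defect_one:
  "f \<in> hardy2 \<Longrightarrow> hinner f (defect_one v) = f (0, 0) - v (0, 0) * hinner f (mult_one v)"
  unfolding defect_one_def[abs_def]
  by (simp add: hinner_diff_right hinner_cmult_right hardy2_cmult emon_hardy2 mult_one_hardy2 hinner_one)

lemma defect_one_zero: "defect_one v (0, 0) = 1 - cnj (v (0, 0)) * v (0, 0)"
  by (simp add: defect_one_def one_apply mult_one_apply zero_in_bidisc)

lemma hinner_defect_one_self: "hinner (defect_one v) (defect_one v) = 1 - v (0, 0) * cnj (v (0, 0))"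
proof -
  have "hinner (defect_one v) (mult_one v) = 0"
    unfolding defect_one_def[abs_def]
    by (simp add: hinner_diff_left hinner_cmult_left hardy2_cmult emon_hardy2 mult_one_hardy2 hinner_mult_one_self hinner_mult_one_one)
  then show ?thesis by (simp add: hinner_defect_one defect_one_hardy2 defect_one_zero)
qed

lemma centred_one_hardy2: "(centred_one v) \<in> hardy2"
  unfolding centred_one_def[abs_def] by (intro hardy2_diff hardy2_cmult emon_hardy2 mult_one_hardy2)

lemma hinner_centred_one_self: "hinner (centred_one v) (centred_one v) = 1 - v (0, 0) * cnj (v (0, 0))"
  using centred_one_hardy2 unfolding centred_one_def[abs_def]
  by (simp add: hinner_diff_left hinner_diff_right hinner_cmult_left hinner_cmult_right hardy2_cmult
      emon_hardy2 mult_one_hardy2 hinner_mult_one_self hinner_mult_one_one hinner_one_one)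

lemma mult_adj_centred_one: "mult_adj v (centred_one v) = (\<lambda>p. (1 - v (0, 0) * cnj (v (0, 0))) * one p)"
  unfolding centred_one_def[abs_def]
  by (simp add: mult_adj_diff mult_adj_cmult v hardy2_cmult emon_hardy2 mult_one_hardy2 mult_adj_mult_one mult_adj_one algebra_simps)

end

section \<open>The first factor\<close>

text \<open>Here \<open>f = (\<theta> - \<theta> 0)/z\<close> and \<open>h = 1 - cnj (\<theta> 0) \<theta>\<close> give
  \<open>\<theta> 0 * (1 - \<theta> 0 * cnj (\<theta> 0)) = 0\<close>. If \<open>\<theta> 0 = 0\<close>, put \<open>k = \<theta>/z\<close>, which has
  norm one. Its backward shift \<open>l\<close> and \<open>k\<close> itself are admissible, and
  \<open>z l = k - k(0)\<close> turns orthogonality into \<open>|k(0)| = 1\<close>, so \<open>k\<close> is constant.\<close>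

lemma first_factor:
  assumes u: "isometric_multiplier (\<lambda>p. \<theta> (fst p))"
    and H: "\<And>f h. f \<in> hardy2 \<Longrightarrow> h \<in> hardy2 \<Longrightarrow>
      mult_adj (\<lambda>p. \<theta> (fst p)) f = (\<lambda>p. 0) \<Longrightarrow> mult_adj (\<lambda>p. \<theta> (fst p)) h = (\<lambda>p. 0) \<Longrightarrow>
      mult_adj snd f = (\<lambda>p. 0) \<Longrightarrow> mult_adj snd h = (\<lambda>p. 0) \<Longrightarrow> hinner (\<lambda>p. fst p * f p) h = 0"
  shows "\<theta> constant_on ball 0 1 \<or> (\<exists>c\<in>sphere 0 1. \<forall>z\<in>ball 0 1. \<theta> z = c * z)"
proof -
  note F = isometric_multiplier_fst and S = isometric_multiplier_snd
  let ?v = "\<lambda>p. \<theta> (fst p)"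
  let ?t = "mult_one ?v" and ?a = "\<theta> 0" and ?h = "defect_one ?v"
  have t: "?t \<in> hardy2" by (rule mult_one_hardy2[OF u])
  have ta: "?t (z, w) = \<theta> z" if "(z, w) \<in> bidisc" for z w using mult_one_apply[OF u that] by simp
  have Bt: "mult_adj snd ?t = (\<lambda>p. 0)"
    unfolding mult_adj_snd_eq_0_iff[OF t] using ta by (auto simp: bidisc_iff)
  define k where "k = mult_adj fst ?t"
  have k: "k \<in> hardy2" unfolding k_def by (rule mult_adj_hardy2[OF F t])
  have uk: "mult_adj ?v k = (\<lambda>p. 0)"
    unfolding k_def by (simp only: mult_adj_commute[OF u F t] mult_adj_mult_one[OF u] shifts_one)
  have Bk: "mult_adj snd k = (\<lambda>p. 0)"
    unfolding k_def by (simp only: mult_adj_commute[OF S F t] Bt mult_adj_zero[OF F])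
  have zk: "(\<lambda>p. fst p * k p) = centred_one ?v"
  proof (rule hardy2_eqI[OF mult_hardy2[OF F k] centred_one_hardy2[OF u]])
    fix p assume p: "p \<in> bidisc"
    obtain z w where zw: "p = (z, w)" by (cases p)
    then have "(0, w) \<in> bidisc" using p by (simp add: bidisc_iff)
    then show "fst p * k p = centred_one ?v p"
      using mult_adj_fst_eq[OF t, of z w] p ta[of 0 w] one_apply[of p]
      by (simp add: k_def zw centred_one_def)
  qed
  have Bh: "mult_adj snd ?h = (\<lambda>p. 0)"
    unfolding defect_one_def[abs_def]
    by (simp add: mult_adj_diff mult_adj_cmult S hardy2_cmult emon_hardy2 t Bt shifts_one)
  have "hinner (centred_one ?v) ?h = 0"
    using H[OF k defect_one_hardy2[OF u] uk mult_adj_defect_one[OF u] Bk Bh] by (simp add: zk)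
  moreover have "hinner (centred_one ?v) ?h = - ?a * (1 - ?a * cnj ?a)"
  proof -
    have "hinner (centred_one ?v) ?t = 1 - ?a * cnj ?a"
      unfolding centred_one_def[abs_def]
      by (simp add: hinner_diff_left hinner_cmult_left hardy2_cmult emon_hardy2 t hinner_mult_one_self[OF u] hinner_mult_one_one[OF u])
    moreover have "centred_one ?v (0, 0) = 0"
      by (simp add: centred_one_def ta zero_in_bidisc one_apply)
    ultimately show ?thesis by (simp add: hinner_defect_one[OF u centred_one_hardy2[OF u]])
  qed
  ultimately consider "?a * cnj ?a = 1" | "?a = 0" by fastforce
  then show ?thesis
  proof cases
    case 1
    have "\<theta> z = ?a" if "z \<in> ball 0 1" for z
      using constant_if_unimodular_at_0[OF u, of "(z, 0)"] 1 that by (simp add: bidisc_iff)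
    then show ?thesis unfolding constant_on_def by blast
  next
    case 2
    have zk': "(\<lambda>p. fst p * k p) = ?t" using zk by (simp add: centred_one_def[abs_def] 2)
    have kk: "hinner k k = 1"
      using hinner_mult_mult[OF F k k] hinner_mult_one_self[OF u] by (simp add: zk')
    define l where "l = mult_adj fst k"
    let ?c = "k (0, 0)"
    have l: "l \<in> hardy2" unfolding l_def by (rule mult_adj_hardy2[OF F k])
    have ul: "mult_adj ?v l = (\<lambda>p. 0)"
      unfolding l_def by (simp only: mult_adj_commute[OF u F k] uk mult_adj_zero[OF F])
    have Bl: "mult_adj snd l = (\<lambda>p. 0)"
      unfolding l_def by (simp only: mult_adj_commute[OF S F k] Bk mult_adj_zero[OF F])
    have "(\<lambda>p. fst p * l p) = (\<lambda>p. k p - ?c * one p)"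
    proof (rule hardy2_eqI[OF mult_hardy2[OF F l] hardy2_diff[OF k hardy2_cmult(1)[OF emon_hardy2]]])
      fix p assume p: "p \<in> bidisc"
      obtain z w where zw: "p = (z, w)" by (cases p)
      then have "(0, w) \<in> bidisc" using p by (simp add: bidisc_iff)
      then have "k (0, w) = ?c" using Bk mult_adj_snd_eq_0_iff[OF k] by blast
      then show "fst p * l p = k p - ?c * one p"
        using mult_adj_fst_eq[OF k, of z w] p one_apply[of p] by (simp add: l_def zw)
    qed
    then have "hinner (\<lambda>p. k p - ?c * one p) k = 0" using H[OF l k ul uk Bl Bk] by simp
    then have cc: "?c * cnj ?c = 1"
      using k kk by (simp add: hinner_diff_left hinner_cmult_left hardy2_cmult emon_hardy2 hinner_one_left)
    have kc: "k = (\<lambda>p. ?c * one p)"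
      by (rule hardy2_eq_cmultI[OF k emon_hardy2]) (simp_all add: hinner_one k kk cc hinner_one_one one_apply zero_in_bidisc)
    have "\<theta> z = ?c * z" if "z \<in> ball 0 1" for z
    proof -
      have z: "(z, 0) \<in> bidisc" using that by (simp add: bidisc_iff)
      have "\<theta> z = fst (z, 0::complex) * k (z, 0)" using fun_cong[OF zk', of "(z, 0)"] ta[OF z] by simp
      also have "\<dots> = z * ?c" using fun_cong[OF kc, of "(z, 0)"] one_apply[OF z] by simp
      finally show ?thesis by simp
    qed
    moreover have "cmod ?c = 1" using cc by (rule cmod_eq_1I)
    ultimately show ?thesis by (auto intro!: bexI[of _ ?c])
  qed
qed

section \<open>The second factor\<close>

lemma second_factor_facts:
  assumes u: "isometric_multiplier (\<lambda>p. \<theta> (snd p))"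
  shows mult_one_snd_apply: "(z, w) \<in> bidisc \<Longrightarrow> mult_one (\<lambda>p. \<theta> (snd p)) (z, w) = \<theta> w"
    and shift_mult_one_snd: "mult_adj fst (mult_one (\<lambda>p. \<theta> (snd p))) = (\<lambda>p. 0)"
    and shift_defect_one_snd: "mult_adj fst (defect_one (\<lambda>p. \<theta> (snd p))) = (\<lambda>p. 0)"
    and mult_shift_mult_one_snd:
      "(\<lambda>p. snd p * mult_adj snd (mult_one (\<lambda>p. \<theta> (snd p))) p) = centred_one (\<lambda>p. \<theta> (snd p))"
proof -
  note F = isometric_multiplier_fst and S = isometric_multiplier_snd
  let ?v = "\<lambda>p. \<theta> (snd p)"
  let ?t = "mult_one ?v"
  have t: "?t \<in> hardy2" by (rule mult_one_hardy2[OF u])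
  show ta: "?t (z, w) = \<theta> w" if "(z, w) \<in> bidisc" for z w using mult_one_apply[OF u that] by simp
  show Bt: "mult_adj fst ?t = (\<lambda>p. 0)"
    unfolding mult_adj_fst_eq_0_iff[OF t] using ta by (auto simp: bidisc_iff)
  show "mult_adj fst (defect_one ?v) = (\<lambda>p. 0)"
    unfolding defect_one_def[abs_def]
    by (simp add: mult_adj_diff mult_adj_cmult F hardy2_cmult emon_hardy2 t Bt shifts_one)
  show "(\<lambda>p. snd p * mult_adj snd ?t p) = centred_one ?v"
  proof (rule hardy2_eqI[OF mult_hardy2[OF S mult_adj_hardy2[OF S t]] centred_one_hardy2[OF u]])
    fix p assume p: "p \<in> bidisc"
    obtain z w where zw: "p = (z, w)" by (cases p)
    then have "(z, 0) \<in> bidisc" using p by (simp add: bidisc_iff)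
    then show "snd p * mult_adj snd ?t p = centred_one ?v p"
      using mult_adj_snd_eq[OF t, of z w] p ta[of z 0] one_apply[of p]
      by (simp add: zw centred_one_def)
  qed
qed

text \<open>With \<open>N = 1 - |\<theta> 0|\<^sup>2\<close>, both \<open>k = (\<theta> - \<theta> 0)/w\<close> and \<open>h = 1 - cnj (\<theta> 0) \<theta>\<close>
  have squared norm \<open>N\<close>, and their inner product is \<open>k(0)\<close>. If \<open>N = 0\<close> then \<open>\<theta>\<close> is
  constant. Otherwise the identity for \<open>f = k\<close> and \<open>k\<close> in place of \<open>h\<close> gives \<open>|k(0)| = N\<close>, equality in the Cauchy-Schwarz inequality, so \<open>k\<close> is a unimodular multiple
  of \<open>h\<close>. Solving for \<open>\<theta>\<close> gives the Moebius map.\<close>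

lemma second_factor_Moebius:
  assumes u: "isometric_multiplier (\<lambda>p. \<theta> (snd p))"
    and H: "\<And>f h. f \<in> hardy2 \<Longrightarrow> h \<in> hardy2 \<Longrightarrow>
      mult_adj fst f = (\<lambda>p. 0) \<Longrightarrow> mult_adj fst h = (\<lambda>p. 0) \<Longrightarrow>
      mult_adj (\<lambda>p. \<theta> (snd p)) f = (\<lambda>p. 0) \<Longrightarrow> mult_adj (\<lambda>p. \<theta> (snd p)) h = (\<lambda>p. 0) \<Longrightarrow>
      f (0, 0) * cnj (h (0, 0)) =
        hinner (mult_adj (\<lambda>p. \<theta> (snd p)) (\<lambda>p. snd p * f p)) (mult_adj (\<lambda>p. \<theta> (snd p)) (\<lambda>p. snd p * h p))"
  shows "\<theta> constant_on ball 0 1 \<or>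
    (\<exists>b\<in>ball 0 1. \<exists>c\<in>sphere 0 1. \<forall>w\<in>ball 0 1. \<theta> w = c * ((w - b) / (1 - cnj b * w)))"
proof -
  note F = isometric_multiplier_fst and S = isometric_multiplier_snd
  let ?v = "\<lambda>p. \<theta> (snd p)"
  let ?t = "mult_one ?v" and ?a = "\<theta> 0" and ?h = "defect_one ?v"
  have t: "?t \<in> hardy2" by (rule mult_one_hardy2[OF u])
  have h: "?h \<in> hardy2" by (rule defect_one_hardy2[OF u])
  define k where "k = mult_adj snd ?t"
  have k: "k \<in> hardy2" unfolding k_def by (rule mult_adj_hardy2[OF S t])
  have uk: "mult_adj ?v k = (\<lambda>p. 0)"
    unfolding k_def by (simp only: mult_adj_commute[OF u S t] mult_adj_mult_one[OF u] shifts_one)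
  have Bk: "mult_adj fst k = (\<lambda>p. 0)"
    unfolding k_def by (simp only: mult_adj_commute[OF F S t] shift_mult_one_snd[OF u] mult_adj_zero[OF S])
  have wk: "(\<lambda>p. snd p * k p) = centred_one ?v" unfolding k_def by (rule mult_shift_mult_one_snd[OF u])
  define N where "N = 1 - (cmod ?a)\<^sup>2"
  have N: "complex_of_real N = 1 - ?a * cnj ?a"
    unfolding N_def by (simp only: of_real_diff of_real_1 complex_norm_square)
  have kk: "hinner k k = of_real N"
    using hinner_mult_mult[OF S k k] hinner_centred_one_self[OF u] by (simp add: wk N)
  have N0: "N \<ge> 0"
    using kk norm2_nonneg[of k] by (simp add: hinner_self[OF k])
  show ?thesis
  proof (cases "N = 0")
    case True
    then have "?a * cnj ?a = 1" using N by simp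
    then have "\<theta> w = ?a" if "w \<in> ball 0 1" for w
      using constant_if_unimodular_at_0[OF u, of "(0, w)"] that by (simp add: bidisc_iff)
    then show ?thesis unfolding constant_on_def by blast
  next
    case False
    define l where "l = k (0, 0) / of_real N"
    have "k (0, 0) * cnj (k (0, 0)) = hinner (\<lambda>p. of_real N * one p) (\<lambda>p. of_real N * one p)"
      using H[OF k k Bk Bk uk uk] by (simp add: wk mult_adj_centred_one[OF u] N)
    also have "\<dots> = of_real N * of_real N"
      by (simp add: hinner_cmult_left hinner_cmult_right emon_hardy2 hinner_one_one)
    finally have k0: "k (0, 0) * cnj (k (0, 0)) = of_real N * of_real N" .
    have ll: "l * cnj l = 1"
      using False k0 by (simp add: l_def)
    have hh: "hinner ?h ?h = of_real N" using hinner_defect_one_self[OF u] by (simp add: N)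
    have "hinner k ?t = 0"
      using hinner_mult_right[OF u emon_hardy2 k, of "(0, 0)"] by (simp add: uk hinner_zero_left mult_one_def[abs_def])
    then have kh: "hinner k ?h = l * of_real N"
      using hinner_defect_one[OF u k] False by (simp add: l_def)
    have klh: "k = (\<lambda>p. l * ?h p)"
      by (rule hardy2_eq_cmultI[OF k h]) (simp_all add: kh hh kk ll)
    have l1: "cmod l = 1" by (rule cmod_eq_1I[OF ll])
    define b where "b = - (cnj l * ?a)"
    have a1: "cmod ?a < 1"
    proof -
      have "(cmod ?a)\<^sup>2 < 1" using N0 False by (simp add: N_def)
      then show ?thesis using abs_square_less_1[of "cmod ?a"] by simp
    qed
    have b1: "cmod b < 1" using a1 l1 by (simp add: b_def norm_mult)
    have "\<theta> w = l * ((w - b) / (1 - cnj b * w))" if w: "w \<in> ball 0 1" for w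
    proof -
      have p: "(0, w) \<in> bidisc" using w by (simp add: bidisc_iff)
      have "snd (0::complex, w) * (l * ?h (0, w)) = centred_one ?v (0, w)"
        using fun_cong[OF wk, of "(0, w)"] fun_cong[OF klh, of "(0, w)"] by simp
      then have e: "w * (l * (1 - cnj ?a * \<theta> w)) = \<theta> w - ?a"
        using p by (simp add: centred_one_def defect_one_def mult_one_apply[OF u] one_apply)
      have "cmod (cnj b * w) < 1"
        using b1 w by (simp add: norm_mult) (metis mult_strict_mono' norm_ge_zero mult_1)
      then have nz: "1 - cnj b * w \<noteq> 0" by auto
      have "\<theta> w * (1 - cnj b * w) = \<theta> w + l * cnj ?a * w * \<theta> w"
        by (simp add: b_def algebra_simps)
      also have "\<dots> = w * l + ?a" using e by (simp add: algebra_simps)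
      also have "\<dots> = l * (w - b)"
        using ll by (simp add: b_def algebra_simps flip: mult.assoc)
      finally show ?thesis using nz by (simp add: field_simps)
    qed
    then show ?thesis using b1 l1 by (intro disjI2 bexI[of _ b] bexI[of _ l]) auto
  qed
qed

text \<open>Here \<open>f\<close> is not restricted to the kernel of the adjoint of \<open>\<theta>\<close>. For \<open>f = \<theta>\<close> and
  \<open>h = 1 - cnj (\<theta> 0) \<theta>\<close> the right-hand side vanishes, which leaves \<open>\<theta> 0 = 0\<close> or a unimodular value. If \<open>\<theta> 0 = 0\<close>,
  then \<open>f = h = 1\<close> shows that the adjoint of \<open>\<theta>\<close> maps \<open>w\<close> to a constant \<open>y\<close>
  of modulus one, and this constant is the conjugate of the value at \<open>0\<close> of \<open>\<theta>/w\<close>, a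
  function of norm one.\<close>

lemma second_factor_linear:
  assumes u: "isometric_multiplier (\<lambda>p. \<theta> (snd p))"
    and H: "\<And>f h. f \<in> hardy2 \<Longrightarrow> h \<in> hardy2 \<Longrightarrow>
      mult_adj fst f = (\<lambda>p. 0) \<Longrightarrow> mult_adj fst h = (\<lambda>p. 0) \<Longrightarrow> mult_adj (\<lambda>p. \<theta> (snd p)) h = (\<lambda>p. 0) \<Longrightarrow>
      f (0, 0) * cnj (h (0, 0)) =
        hinner (mult_adj (\<lambda>p. \<theta> (snd p)) (\<lambda>p. snd p * f p)) (mult_adj (\<lambda>p. \<theta> (snd p)) (\<lambda>p. snd p * h p))"
  shows "\<theta> constant_on ball 0 1 \<or> (\<exists>c\<in>sphere 0 1. \<forall>w\<in>ball 0 1. \<theta> w = c * w)"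
proof -
  note F = isometric_multiplier_fst and S = isometric_multiplier_snd
  let ?v = "\<lambda>p. \<theta> (snd p)"
  let ?t = "mult_one ?v" and ?a = "\<theta> 0" and ?h = "defect_one ?v"
  define w1 where "w1 = (\<lambda>p. snd p * one p)"
  define y where "y = mult_adj ?v w1"
  have t: "?t \<in> hardy2" by (rule mult_one_hardy2[OF u])
  have h: "?h \<in> hardy2" by (rule defect_one_hardy2[OF u])
  have w1: "w1 \<in> hardy2" unfolding w1_def by (rule mult_hardy2[OF S emon_hardy2])
  have y: "y \<in> hardy2" unfolding y_def by (rule mult_adj_hardy2[OF u w1])
  have w1w1: "hinner w1 w1 = 1"
    unfolding w1_def by (simp add: hinner_mult_mult[OF S] emon_hardy2 hinner_one_one)
  have wt: "(\<lambda>p. snd p * ?t p) = (\<lambda>p. ?v p * w1 p)"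
    by (simp add: mult_one_def w1_def mult_ac)
  have "hinner w1 y = hinner (\<lambda>p. ?v p * w1 p) w1"
    unfolding y_def by (rule hinner_mult_left[OF u w1 w1, symmetric])
  also have "\<dots> = hinner (\<lambda>p. snd p * ?t p) (\<lambda>p. snd p * one p)"
    by (simp only: wt w1_def)
  also have "\<dots> = ?a"
    by (simp add: hinner_mult_mult[OF S] t emon_hardy2 hinner_mult_one_one[OF u])
  finally have w1y: "hinner w1 y = ?a" .
  have wh: "(\<lambda>p. snd p * ?h p) = (\<lambda>p. w1 p - cnj ?a * (?v p * w1 p))"
    by (simp add: defect_one_def mult_one_def w1_def algebra_simps)
  have "mult_adj ?v (\<lambda>p. snd p * ?t p) = w1"
    unfolding wt by (rule mult_adj_mult[OF u w1])
  moreover have "mult_adj ?v (\<lambda>p. snd p * ?h p) = (\<lambda>p. y p - cnj ?a * w1 p)"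
    unfolding wh y_def
    by (simp add: mult_adj_diff mult_adj_cmult mult_adj_mult u w1 hardy2_cmult mult_hardy2)
  ultimately have "?t (0, 0) * cnj (?h (0, 0)) = hinner w1 (\<lambda>p. y p - cnj ?a * w1 p)"
    using H[OF t h shift_mult_one_snd[OF u] shift_defect_one_snd[OF u] mult_adj_defect_one[OF u]] by simp
  also have "\<dots> = 0"
    by (simp add: hinner_diff_right hinner_cmult_right w1 y hardy2_cmult w1y w1w1)
  finally have "?a * (1 - ?a * cnj ?a) = 0"
    by (simp add: mult_one_snd_apply[OF u zero_in_bidisc] defect_one_zero[OF u])
  then consider "?a * cnj ?a = 1" | "?a = 0" by fastforce
  then show ?thesis
  proof cases
    case 1
    then have "\<theta> w = ?a" if "w \<in> ball 0 1" for w
      using constant_if_unimodular_at_0[OF u, of "(0, w)"] that by (simp add: bidisc_iff)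
    then show ?thesis unfolding constant_on_def by blast
  next
    case 2
    have u1: "mult_adj ?v one = (\<lambda>p. 0)" by (simp add: mult_adj_one[OF u] 2)
    have "one (0, 0) * cnj (one (0, 0)) = hinner y y"
      unfolding y_def w1_def by (rule H[OF emon_hardy2 emon_hardy2 shifts_one(1) shifts_one(1) u1])
    then have yy: "hinner y y = 1" by (simp add: one_apply zero_in_bidisc)
    have "mult_adj snd y = mult_adj ?v (mult_adj snd w1)"
      unfolding y_def by (rule mult_adj_commute[OF S u w1])
    also have "mult_adj snd w1 = one" unfolding w1_def by (rule mult_adj_mult[OF S emon_hardy2])
    finally have By: "mult_adj snd y = (\<lambda>p. 0)" by (simp add: u1)
    have "mult_adj fst w1 = (\<lambda>p. 0)"
      unfolding mult_adj_fst_eq_0_iff[OF w1] by (auto simp: w1_def one_apply bidisc_iff)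
    then have "mult_adj fst y = (\<lambda>p. 0)"
      unfolding y_def mult_adj_commute[OF F u w1] by (simp add: mult_adj_zero u)
    from constant_if_shifts_zero[OF y this By] have yc: "y = (\<lambda>p. y (0, 0) * one p)" .
    have yy0: "y (0, 0) * cnj (y (0, 0)) = 1"
      using yy by (subst (asm) (1 2) yc) (simp add: hinner_cmult_left hinner_cmult_right emon_hardy2 hinner_one_one hardy2_cmult mult.commute)
    define k where "k = mult_adj snd ?t"
    have k: "k \<in> hardy2" unfolding k_def by (rule mult_adj_hardy2[OF S t])
    have wk: "(\<lambda>p. snd p * k p) = ?t"
      unfolding k_def using mult_shift_mult_one_snd[OF u] by (simp add: centred_one_def[abs_def] 2)
    have kk: "hinner k k = 1"
      using hinner_mult_mult[OF S k k] hinner_mult_one_self[OF u] by (simp add: wk)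
    have "y (0, 0) = hinner y one" using hinner_one[OF y] by simp
    also have "\<dots> = hinner w1 ?t"
      unfolding y_def mult_one_def[abs_def] by (rule hinner_mult_right[OF u emon_hardy2 w1, symmetric])
    also have "\<dots> = hinner one k"
      using hinner_mult_mult[OF S emon_hardy2 k, of "(0, 0)"] by (simp add: wk w1_def)
    also have "\<dots> = cnj (k (0, 0))" by (rule hinner_one_left[OF k])
    finally have cc: "k (0, 0) * cnj (k (0, 0)) = 1" using yy0 by (simp add: mult.commute)
    let ?c = "k (0, 0)"
    have kc: "k = (\<lambda>p. ?c * one p)"
      by (rule hardy2_eq_cmultI[OF k emon_hardy2]) (simp_all add: hinner_one k kk cc hinner_one_one one_apply zero_in_bidisc)
    have "\<theta> w = ?c * w" if "w \<in> ball 0 1" for w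
    proof -
      have w: "(0, w) \<in> bidisc" using that by (simp add: bidisc_iff)
      have "\<theta> w = snd (0::complex, w) * k (0, w)"
        using fun_cong[OF wk, of "(0, w)"] mult_one_snd_apply[OF u w] by simp
      also have "\<dots> = w * ?c" using fun_cong[OF kc, of "(0, w)"] one_apply[OF w] by simp
      finally show ?thesis by simp
    qed
    then show ?thesis using cmod_eq_1I[OF cc] by (intro disjI2 bexI[of _ ?c]) auto
  qed
qed

section \<open>The characterization\<close>

lemma first_factor_of_phi_doubly_commuting:
  assumes u1: "isometric_multiplier (\<lambda>p. \<theta>\<^sub>1 (fst p))" and u2: "isometric_multiplier v"
    and comm: "phi_doubly_commuting (orth_compl (principal (\<lambda>p. \<theta>\<^sub>1 (fst p) * v p)))"
  shows "\<theta>\<^sub>1 constant_on ball 0 1 \<or> (\<exists>c\<in>sphere 0 1. \<forall>z\<in>ball 0 1. \<theta>\<^sub>1 z = c * z)"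
proof (rule first_factor[OF u1])
  fix f h assume f: "f \<in> hardy2" and h: "h \<in> hardy2"
    and uf: "mult_adj (\<lambda>p. \<theta>\<^sub>1 (fst p)) f = (\<lambda>p. 0)" and uh: "mult_adj (\<lambda>p. \<theta>\<^sub>1 (fst p)) h = (\<lambda>p. 0)"
    and Bf: "mult_adj snd f = (\<lambda>p. 0)" and Bh: "mult_adj snd h = (\<lambda>p. 0)"
  note u = isometric_multiplier_mult[OF u1 u2] and S = isometric_multiplier_snd
  note A = mult_adj_mult_compose[OF u1 u2]
  have "mult_adj (\<lambda>p. \<theta>\<^sub>1 (fst p) * v p) (\<lambda>p. snd p * h p) = (\<lambda>p. 0)"
    unfolding A[OF mult_hardy2[OF S h]] mult_adj_fst_fun_mult_snd[OF u1 h] uh by (simp add: mult_adj_zero u2)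
  moreover have "mult_adj (\<lambda>p. \<theta>\<^sub>1 (fst p) * v p) f = (\<lambda>p. 0)" "mult_adj (\<lambda>p. \<theta>\<^sub>1 (fst p) * v p) h = (\<lambda>p. 0)"
    by (simp_all add: A f h uf uh mult_adj_zero u2)
  ultimately show "hinner (\<lambda>p. fst p * f p) h = 0"
    using phi_doubly_commuting_weak[OF u comm f _ h] by (simp add: Bf hinner_zero_right)
qed

lemma value_times_one:
  assumes f: "f \<in> hardy2" and B: "mult_adj fst f = (\<lambda>p. 0)"
  shows "(\<lambda>p. fst p * (f p - snd p * mult_adj snd f p)) = (\<lambda>p. f (0, 0) * (fst p * one p))"
proof
  fix p
  show "fst p * (f p - snd p * mult_adj snd f p) = f (0, 0) * (fst p * one p)"
  proof (cases "p \<in> bidisc")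
    case True
    obtain z w where p: "p = (z, w)" by (cases p)
    then have "f (z, 0) = f (0, 0)"
      using B mult_adj_fst_eq_0_iff[OF f] True by (auto simp: bidisc_iff)
    then show ?thesis using mult_adj_snd_eq[OF f, of z w] True one_apply[OF True] by (simp add: p)
  next
    case False
    then show ?thesis
      using hardy2_outside[OF f False] hardy2_outside[OF mult_adj_hardy2[OF isometric_multiplier_snd f] False]
      by (simp add: emon_def)
  qed
qed

text \<open>The weak form of the relation at \<open>f\<close> and \<open>z h\<close>. The hypothesis \<open>Az\<close> covers both multipliers that remain once
  the first factor is known: for \<open>u = \<theta>\<^sub>2(w)\<close> the adjoint commutes with \<open>z\<close>, for
  \<open>u = z \<theta>\<^sub>2(w)\<close> it cancels \<open>z\<close>.\<close>

lemma second_factor_identity: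
  assumes v: "isometric_multiplier v" and u: "isometric_multiplier u"
    and comm: "phi_doubly_commuting (orth_compl (principal u))"
    and Az: "\<And>g h. g \<in> hardy2 \<Longrightarrow> h \<in> hardy2 \<Longrightarrow>
      hinner (mult_adj u (\<lambda>p. fst p * g p)) (mult_adj u (\<lambda>p. fst p * h p)) = hinner (mult_adj v g) (mult_adj v h)"
    and f: "f \<in> hardy2" "mult_adj fst f = (\<lambda>p. 0)" "mult_adj u f = (\<lambda>p. 0)"
    and h: "h \<in> hardy2" "mult_adj u (\<lambda>p. fst p * h p) = (\<lambda>p. 0)"
  shows "f (0, 0) * cnj (h (0, 0)) =
    hinner (mult_adj v (\<lambda>p. snd p * f p)) (mult_adj v (\<lambda>p. snd p * h p))"
proof -
  note F = isometric_multiplier_fst and S = isometric_multiplier_snd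
  have zh: "(\<lambda>p. fst p * h p) \<in> hardy2" by (rule mult_hardy2[OF F h(1)])
  have z1: "(\<lambda>p. fst p * one p) \<in> hardy2" by (rule mult_hardy2[OF F emon_hardy2])
  have "f (0, 0) * cnj (h (0, 0)) = hinner (\<lambda>p. f (0, 0) * (fst p * one p)) (\<lambda>p. fst p * h p)"
    by (simp only: hinner_cmult_left[OF z1] hinner_mult_mult[OF F emon_hardy2 h(1)] hinner_one_left[OF h(1)])
  also have "\<dots> = hinner (mult_adj u (\<lambda>p. fst p * (snd p * f p))) (mult_adj u (\<lambda>p. snd p * (fst p * h p)))"
    using phi_doubly_commuting_weak[OF u comm f(1,3) zh h(2)] unfolding value_times_one[OF f(1,2)] .
  also have "(\<lambda>p. snd p * (fst p * h p)) = (\<lambda>p. fst p * (snd p * h p))"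
    by (simp add: mult.left_commute)
  finally show ?thesis by (simp only: Az[OF mult_hardy2[OF S f(1)] mult_hardy2[OF S h(1)]])
qed

text \<open>If \<open>z w\<close> is a multiple of the multiplier, then \<open>Q\<^sub>1 Q\<^sub>2 = 0\<close>.\<close>

lemma phi_doubly_commuting_if_product_zero:
  assumes u: "isometric_multiplier u" and v: "\<And>f. f \<in> hardy2 \<Longrightarrow> (\<lambda>p. v p * f p) \<in> hardy2"
    and eq: "\<And>p. fst p * snd p = u p * v p"
  shows "phi_doubly_commuting (orth_compl (principal u))"
proof -
  have "co_proj u (\<lambda>p. fst p * (snd p * g p)) = (\<lambda>p. 0)" if "g \<in> hardy2" for g
    using co_proj_mult[OF u v[OF that]] eq by (simp add: mult.assoc[symmetric])
  then show ?thesis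
    unfolding phi_doubly_commuting_principal_iff[OF u]
    by (auto simp: orth_compl_principal_iff[OF u] mult_adj_hardy2 mult_adj_zero isometric_multiplier_snd)
qed

lemma phi_doubly_commuting_if_shift_scalar:
  assumes u: "isometric_multiplier u"
    and scalar: "\<And>f. f \<in> orth_compl (principal u) \<Longrightarrow> mult_adj snd f = (\<lambda>p. c * f p)"
  shows "phi_doubly_commuting (orth_compl (principal u))"
  unfolding phi_doubly_commuting_principal_iff[OF u]
proof
  note F = isometric_multiplier_fst and S = isometric_multiplier_snd
  fix f assume f: "f \<in> orth_compl (principal u)"
  then have "f \<in> hardy2" by (simp add: orth_compl_def)
  then have g: "(\<lambda>p. fst p * (snd p * f p)) \<in> hardy2" by (intro mult_hardy2 F S)
  have "co_proj u (\<lambda>p. fst p * (snd p * mult_adj snd f p)) = co_proj u (\<lambda>p. c * (fst p * (snd p * f p)))"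
    by (simp add: scalar[OF f] mult.left_commute)
  also have "\<dots> = mult_adj snd (co_proj u (\<lambda>p. fst p * (snd p * f p)))"
    by (simp add: co_proj_cmult[OF u g] scalar[OF co_proj_in[OF u g]])
  finally show "co_proj u (\<lambda>p. fst p * (snd p * mult_adj snd f p)) = mult_adj snd (co_proj u (\<lambda>p. fst p * (snd p * f p)))" .
qed

text \<open>The factor \<open>w - b\<close> is a unit multiple of \<open>\<theta>\<close>, with inverse multiple \<open>cnj c * (1 - cnj b * w)\<close>. Hence
  \<open>(w - b) g\<close> lies in the submodule for every \<open>g\<close>, and \<open>f\<close> is orthogonal to it.\<close>

lemma Moebius_shift_scalar:
  assumes u: "isometric_multiplier (\<lambda>p. \<theta> (snd p))" and b: "cmod b < 1" and c: "cmod c = 1"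
    and \<theta>: "\<And>w. cmod w < 1 \<Longrightarrow> \<theta> w = c * ((w - b) / (1 - cnj b * w))"
    and f: "f \<in> orth_compl (principal (\<lambda>p. \<theta> (snd p)))"
  shows "mult_adj snd f = (\<lambda>p. cnj b * f p)"
proof (rule mult_adj_unique[OF isometric_multiplier_snd])
  note S = isometric_multiplier_snd
  show fh: "f \<in> hardy2" using f by (simp add: orth_compl_def)
  show "(\<lambda>p. cnj b * f p) \<in> hardy2" by (rule hardy2_cmult(1)[OF fh])
  fix g assume g: "g \<in> hardy2"
  define k where "k = (\<lambda>p. cnj c * (g p - cnj b * (snd p * g p)))"
  have wg: "(\<lambda>p. snd p * g p) \<in> hardy2" by (rule mult_hardy2[OF S g])
  have bg: "(\<lambda>p. b * g p) \<in> hardy2" by (rule hardy2_cmult(1)[OF g])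
  have k: "k \<in> hardy2" unfolding k_def by (intro hardy2_cmult hardy2_diff g wg)
  have cc: "c * cnj c = 1" using c complex_norm_square[of c] by simp
  have "(\<lambda>p. snd p * g p - b * g p) = (\<lambda>p. \<theta> (snd p) * k p)"
  proof (rule hardy2_eqI[OF hardy2_diff[OF wg bg] mult_hardy2[OF u k]])
    fix p :: "complex \<times> complex" assume "p \<in> bidisc"
    then have w: "cmod (snd p) < 1" by (cases p) (simp add: bidisc_iff)
    have "cmod (cnj b * snd p) < 1"
      using b w by (simp add: norm_mult) (metis mult_strict_mono' norm_ge_zero mult_1)
    then have nz: "1 - cnj b * snd p \<noteq> 0" by auto
    have "k p = cnj c * ((1 - cnj b * snd p) * g p)"
      by (simp add: k_def algebra_simps)
    then have "\<theta> (snd p) * k p = (c * cnj c) * (((snd p - b) / (1 - cnj b * snd p)) * ((1 - cnj b * snd p) * g p))"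
      by (simp only: \<theta>[OF w] mult_ac)
    also have "\<dots> = (snd p - b) * g p" using nz cc by simp
    finally show "snd p * g p - b * g p = \<theta> (snd p) * k p" by (simp add: algebra_simps)
  qed
  then have "(\<lambda>p. snd p * g p - b * g p) \<in> principal (\<lambda>p. \<theta> (snd p))"
    using k by (auto simp: principal_def)
  then have "hinner f (\<lambda>p. snd p * g p - b * g p) = 0" using f by (simp add: orth_compl_def)
  then have "hinner f (\<lambda>p. snd p * g p) = hinner f (\<lambda>p. b * g p)"
    by (simp add: hinner_diff_right fh wg bg)
  then have "hinner (\<lambda>p. snd p * g p) f = hinner (\<lambda>p. b * g p) f" by (metis hinner_cnj)
  also have "\<dots> = hinner g (\<lambda>p. cnj b * f p)"
    by (simp add: hinner_cmult_left[OF g] hinner_cmult_right[OF fh])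
  finally show "hinner (\<lambda>p. snd p * g p) f = hinner g (\<lambda>p. cnj b * f p)" .
qed

lemma inner_constant_nonzero:
  assumes u: "isometric_multiplier (\<lambda>p. \<theta> (fst p)) \<or> isometric_multiplier (\<lambda>p. \<theta> (snd p))"
    and "\<theta> constant_on ball 0 1"
  obtains c where "c \<noteq> 0" "\<And>z. cmod z < 1 \<Longrightarrow> \<theta> z = c"
proof -
  obtain c where c: "\<And>z. z \<in> ball 0 1 \<Longrightarrow> \<theta> z = c" using assms(2) by (auto simp: constant_on_def)
  have nz: "False" if v: "isometric_multiplier v" and "\<And>p. p \<in> bidisc \<Longrightarrow> v p = 0" for v
  proof -
    have "mult_one v = (\<lambda>p. 0)"
      using that(2) by (auto simp: mult_one_def fun_eq_iff emon_def)
    then show False using hinner_mult_one_self[OF v] by (simp add: hinner_zero_left)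
  qed
  have "c \<noteq> 0"
  proof
    assume "c = 0"
    then have "\<theta> (fst p) = 0" "\<theta> (snd p) = 0" if "p \<in> bidisc" for p
      using c that by (auto simp: bidisc_def)
    then show False using u nz by blast
  qed
  then show ?thesis using that c by auto
qed

theorem theorem3p11:
  fixes \<theta>\<^sub>1 \<theta>\<^sub>2 :: "complex \<Rightarrow> complex"
  assumes "inner_function \<theta>\<^sub>1" and "inner_function \<theta>\<^sub>2"
  shows "phi_doubly_commuting (orth_compl (product_submodule \<theta>\<^sub>1 \<theta>\<^sub>2)) \<longleftrightarrow>
     (\<theta>\<^sub>1 constant_on ball 0 1 \<and> \<theta>\<^sub>2 constant_on ball 0 1) \<or>
     (\<theta>\<^sub>1 constant_on ball 0 1 \<and>
       (\<exists>b\<in>ball 0 1. \<exists>c\<in>sphere 0 1. \<forall>w\<in>ball 0 1. \<theta>\<^sub>2 w = c * ((w - b) / (1 - cnj b * w)))) \<or>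
     (\<theta>\<^sub>2 constant_on ball 0 1 \<and>
       (\<exists>c\<^sub>1\<in>sphere 0 1. \<forall>z\<in>ball 0 1. \<theta>\<^sub>1 z = c\<^sub>1 * z)) \<or>
     ((\<exists>c\<^sub>1\<in>sphere 0 1. \<forall>z\<in>ball 0 1. \<theta>\<^sub>1 z = c\<^sub>1 * z) \<and>
       (\<exists>c\<^sub>2\<in>sphere 0 1. \<forall>w\<in>ball 0 1. \<theta>\<^sub>2 w = c\<^sub>2 * w))"
    (is "phi_doubly_commuting (orth_compl ?M) \<longleftrightarrow> ?R")
proof -
  note F = isometric_multiplier_fst and S = isometric_multiplier_snd
  have u1: "isometric_multiplier (\<lambda>p. \<theta>\<^sub>1 (fst p))" and u2: "isometric_multiplier (\<lambda>p. \<theta>\<^sub>2 (snd p))"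
    using isometric_multiplier_inner assms by blast+
  note zu2 = isometric_multiplier_mult[OF F u2]
  have one: "isometric_multiplier (\<lambda>p. 1)"
    by (simp add: isometric_multiplier_def emon_hardy2 hinner_emon coef_emon)
  have M: "?M = principal (\<lambda>p. \<theta>\<^sub>1 (fst p) * \<theta>\<^sub>2 (snd p))"
    by (rule product_submodule_eq_principal[of 1]) simp_all
  have M_const: "?M = principal (\<lambda>p. \<theta>\<^sub>2 (snd p))" if const: "\<theta>\<^sub>1 constant_on ball 0 1"
  proof -
    obtain c where "c \<noteq> 0" "\<And>z. cmod z < 1 \<Longrightarrow> \<theta>\<^sub>1 z = c"
      using inner_constant_nonzero[OF disjI1[OF u1] const] by metis
    then show ?thesis by (intro product_submodule_eq_principal[of c]) (simp_all add: bidisc_iff)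
  qed
  have M_lin: "?M = principal (\<lambda>p. fst p * \<theta>\<^sub>2 (snd p))"
    if lin: "\<exists>c\<in>sphere 0 1. \<forall>z\<in>ball 0 1. \<theta>\<^sub>1 z = c * z"
  proof -
    obtain c where c: "cmod c = 1" "\<And>z. cmod z < 1 \<Longrightarrow> \<theta>\<^sub>1 z = c * z" using lin by auto
    then have "c \<noteq> 0" by auto
    with c show ?thesis by (intro product_submodule_eq_principal[of c]) (simp_all add: bidisc_iff)
  qed
  show ?thesis
  proof
    assume comm: "phi_doubly_commuting (orth_compl ?M)"
    have "\<theta>\<^sub>1 constant_on ball 0 1 \<or> (\<exists>c\<in>sphere 0 1. \<forall>z\<in>ball 0 1. \<theta>\<^sub>1 z = c * z)"
      using first_factor_of_phi_doubly_commuting[OF u1 u2] comm M by simp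
    then show ?R
    proof
      assume const: "\<theta>\<^sub>1 constant_on ball 0 1"
      have "\<theta>\<^sub>2 constant_on ball 0 1 \<or>
        (\<exists>b\<in>ball 0 1. \<exists>c\<in>sphere 0 1. \<forall>w\<in>ball 0 1. \<theta>\<^sub>2 w = c * ((w - b) / (1 - cnj b * w)))"
      proof (rule second_factor_Moebius[OF u2], rule second_factor_identity[OF u2 u2])
        show "phi_doubly_commuting (orth_compl (principal (\<lambda>p. \<theta>\<^sub>2 (snd p))))"
          using comm M_const[OF const] by simp
        show "hinner (mult_adj (\<lambda>p. \<theta>\<^sub>2 (snd p)) (\<lambda>p. fst p * g p)) (mult_adj (\<lambda>p. \<theta>\<^sub>2 (snd p)) (\<lambda>p. fst p * h p)) =
            hinner (mult_adj (\<lambda>p. \<theta>\<^sub>2 (snd p)) g) (mult_adj (\<lambda>p. \<theta>\<^sub>2 (snd p)) h)"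
          if "g \<in> hardy2" "h \<in> hardy2" for g h
          using that by (simp add: mult_adj_snd_fun_mult_fst[OF u2] hinner_mult_mult[OF F] mult_adj_hardy2[OF u2])
        show "mult_adj (\<lambda>p. \<theta>\<^sub>2 (snd p)) (\<lambda>p. fst p * h p) = (\<lambda>p. 0)"
          if "h \<in> hardy2" "mult_adj (\<lambda>p. \<theta>\<^sub>2 (snd p)) h = (\<lambda>p. 0)" for h
          using that by (simp add: mult_adj_snd_fun_mult_fst[OF u2])
      qed
      with const show ?R by blast
    next
      assume lin: "\<exists>c\<in>sphere 0 1. \<forall>z\<in>ball 0 1. \<theta>\<^sub>1 z = c * z"
      have A: "mult_adj (\<lambda>p. fst p * \<theta>\<^sub>2 (snd p)) (\<lambda>p. fst p * g p) = mult_adj (\<lambda>p. \<theta>\<^sub>2 (snd p)) g"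
        if "g \<in> hardy2" for g
        using mult_adj_mult_compose[OF F u2 mult_hardy2[OF F that]] by (simp add: mult_adj_mult[OF F that])
      have "\<theta>\<^sub>2 constant_on ball 0 1 \<or> (\<exists>c\<in>sphere 0 1. \<forall>w\<in>ball 0 1. \<theta>\<^sub>2 w = c * w)"
      proof (rule second_factor_linear[OF u2], rule second_factor_identity[OF u2 zu2])
        show "phi_doubly_commuting (orth_compl (principal (\<lambda>p. fst p * \<theta>\<^sub>2 (snd p))))"
          using comm M_lin[OF lin] by simp
        show "mult_adj (\<lambda>p. fst p * \<theta>\<^sub>2 (snd p)) f = (\<lambda>p. 0)"
          if "f \<in> hardy2" "mult_adj fst f = (\<lambda>p. 0)" for f
          using mult_adj_mult_compose[OF F u2 that(1)] that(2) by (simp add: mult_adj_zero[OF u2])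
      qed (simp_all add: A)
      with lin show ?R by blast
    qed
  next
    assume R: ?R
    have unit: "phi_doubly_commuting (orth_compl ?M)"
      if "c \<noteq> 0" "\<And>z w. (z, w) \<in> bidisc \<Longrightarrow> \<theta>\<^sub>1 z * \<theta>\<^sub>2 w = c * u (z, w)"
        "isometric_multiplier u" "isometric_multiplier v" "\<And>p. fst p * snd p = u p * v p" for c u v
    proof -
      have "?M = principal u" by (rule product_submodule_eq_principal) (fact that(1), rule that(2))
      then show ?thesis
        using phi_doubly_commuting_if_product_zero[OF that(3) mult_hardy2[OF that(4)] that(5)] by simp
    qed
    consider (const) "\<theta>\<^sub>1 constant_on ball 0 1" "\<theta>\<^sub>2 constant_on ball 0 1"
      | (Moebius) "\<theta>\<^sub>1 constant_on ball 0 1"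
          "\<exists>b\<in>ball 0 1. \<exists>c\<in>sphere 0 1. \<forall>w\<in>ball 0 1. \<theta>\<^sub>2 w = c * ((w - b) / (1 - cnj b * w))"
      | (z) "\<theta>\<^sub>2 constant_on ball 0 1" "\<exists>c\<^sub>1\<in>sphere 0 1. \<forall>z\<in>ball 0 1. \<theta>\<^sub>1 z = c\<^sub>1 * z"
      | (zw) "\<exists>c\<^sub>1\<in>sphere 0 1. \<forall>z\<in>ball 0 1. \<theta>\<^sub>1 z = c\<^sub>1 * z" "\<exists>c\<^sub>2\<in>sphere 0 1. \<forall>w\<in>ball 0 1. \<theta>\<^sub>2 w = c\<^sub>2 * w"
      using R by blast
    then show "phi_doubly_commuting (orth_compl ?M)"
    proof cases
      case const
      obtain c d where "c \<noteq> 0" "\<And>z. cmod z < 1 \<Longrightarrow> \<theta>\<^sub>1 z = c" "d \<noteq> 0" "\<And>w. cmod w < 1 \<Longrightarrow> \<theta>\<^sub>2 w = d"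
        using inner_constant_nonzero[OF disjI1[OF u1] const(1)] inner_constant_nonzero[OF disjI2[OF u2] const(2)]
        by metis
      then show ?thesis
        by (intro unit[of "c * d" "\<lambda>p. 1" "\<lambda>p. fst p * snd p"])
          (simp_all add: bidisc_iff one isometric_multiplier_mult[OF F S])
    next
      case Moebius
      then obtain b c where "cmod b < 1" "cmod c = 1"
        "\<And>w. cmod w < 1 \<Longrightarrow> \<theta>\<^sub>2 w = c * ((w - b) / (1 - cnj b * w))" by auto
      from Moebius_shift_scalar[OF u2 this] show ?thesis
        unfolding M_const[OF Moebius(1)] by (rule phi_doubly_commuting_if_shift_scalar[OF u2])
    next
      case z
      obtain d where "d \<noteq> 0" "\<And>w. cmod w < 1 \<Longrightarrow> \<theta>\<^sub>2 w = d"
        using inner_constant_nonzero[OF disjI2[OF u2] z(1)] by metis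
      moreover obtain c where "cmod c = 1" "\<And>z. cmod z < 1 \<Longrightarrow> \<theta>\<^sub>1 z = c * z" using z(2) by auto
      moreover from this have "c \<noteq> 0" by auto
      ultimately show ?thesis
        by (intro unit[of "c * d" fst snd]) (simp_all add: bidisc_iff F S)
    next
      case zw
      obtain c where "cmod c = 1" "\<And>z. cmod z < 1 \<Longrightarrow> \<theta>\<^sub>1 z = c * z" using zw(1) by auto
      moreover obtain d where "cmod d = 1" "\<And>w. cmod w < 1 \<Longrightarrow> \<theta>\<^sub>2 w = d * w" using zw(2) by auto
      moreover from calculation have "c \<noteq> 0" "d \<noteq> 0" by auto
      ultimately show ?thesis
        by (intro unit[of "c * d" "\<lambda>p. fst p * snd p" "\<lambda>p. 1"])
          (simp_all add: bidisc_iff one isometric_multiplier_mult[OF F S])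
    qed
  qed
qed

end
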